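(* A compact space $X$ is skeletally generated if and only if it is weakly $\kappa$-metrizable.
   Context: All topological spaces are assumed Tychonoff (so compact spaces are compact Hausdorff) and all maps continuous. A set $C\subset X$ is regularly closed if it is the closure of an open set; $\mathcal C$ denotes the family of all regularly closed subsets of $X$. Weakly $\kappa$-metrizable: a non-negative function $d:X\times\mathcal C\to\mathbb R$ is a weak $\kappa$-metric on $X$ if: K1)$^*$ for any $C\in\mathcal C$ there is a dense open subset $V$ of $X\setminus C$ such that $d(x,C)>0$ iff $x\in V$; K2) if $C\subset C'$, then $d(x,C')\le d(x,C)$ for every $x\in X$; K3) for every $C$, $d(x,C)$ is a continuous function of $x$; K4)$_0$ for every increasing transfinite (i.e. well-ordered by index) family $\{C_\alpha\}_\alpha\subset\mathcal C$ the function $f(x)=\inf_\alpha d(x,C_\alpha)$ is continuous. $X$ is weakly $\kappa$-metrizable if it admits a weak $\kappa$-metric. Skeletally generated: a map $f:X\to Y$ is skeletal if $\mathrm{Int}\,\overline{f(U)}\ne\varnothing$ for every non-empty open $U\subset X$. A space $X$ is skeletally generated if there is an inverse system $S=\{X_\alpha,p^\beta_\alpha,A\}$ of separable metric spaces $X_\alpha$ with skeletal surjective bonding maps $p^\beta_\alpha:X_\beta\to X_\alpha$ ($\alpha\le\beta$ in the directed set $A$) such that: (1) $A$ is $\sigma$-complete, i.e. every countable chain in $A$ has a supremum in $A$; (2) for every countable chain $\{\alpha_n\}_{n\ge1}\subset A$ with $\beta=\sup\{\alpha_n\}_{n\ge 1}$, the space $X_\beta$ is (via the canonical map induced by the $p^\beta_{\alpha_n}$)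 a (dense) subset of $\varprojlim\{X_{\alpha_n},p^{\alpha_{n+1}}_{\alpha_n}\}$; (3) $X$ is embedded in $\varprojlim S$ and $p_\alpha(X)=X_\alpha$ for each $\alpha$, where $p_\alpha:\varprojlim S\to X_\alpha$ is the $\alpha$-th limit projection. *)

theory Defs
  imports "HOL-Analysis.Analysis"
begin

section \<open>Weakly kappa-metrizable spaces\<close>

definition regularly_closed :: "'a topology \<Rightarrow> 'a set set" where
  "regularly_closed X = {X closure_of U | U. openin X U}"

text \<open>In K4, transfinite families are indexed by arbitrary nonempty well-orders on subsets of
  \<open>'a set\<close>. This index type loses nothing: the range of an increasing transfinite family of
  subsets of \<open>X\<close> is well-ordered by inclusion, so the family can be reindexed by its range
  without changing the infimum.\<close>

definition weak_kappa_metric :: "'a topology \<Rightarrow> ('a \<Rightarrow> 'a set \<Rightarrow> real) \<Rightarrow> bool" where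
  "weak_kappa_metric X d \<longleftrightarrow>
     (\<forall>x \<in> topspace X. \<forall>C \<in> regularly_closed X. 0 \<le> d x C) \<and>
     \<comment> \<open>K1\<close>
     (\<forall>C \<in> regularly_closed X. \<exists>V.
        openin (subtopology X (topspace X - C)) V \<and>
        subtopology X (topspace X - C) closure_of V = topspace X - C \<and>
        (\<forall>x \<in> topspace X. 0 < d x C \<longleftrightarrow> x \<in> V)) \<and>
     \<comment> \<open>K2\<close>
     (\<forall>C \<in> regularly_closed X. \<forall>C' \<in> regularly_closed X.
        C \<subseteq> C' \<longrightarrow> (\<forall>x \<in> topspace X. d x C' \<le> d x C)) \<and>
     \<comment> \<open>K3\<close>
     (\<forall>C \<in> regularly_closed X. continuous_map X euclideanreal (\<lambda>x. d x C)) \<and>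
     \<comment> \<open>K4\<close>
     (\<forall>(I :: 'a set set) r F.
        I \<noteq> {} \<and> well_order_on I r \<and> (\<forall>i \<in> I. F i \<in> regularly_closed X) \<and>
        (\<forall>(i, j) \<in> r. F i \<subseteq> F j) \<longrightarrow>
        continuous_map X euclideanreal (\<lambda>x. INF i \<in> I. d x (F i)))"

definition weakly_kappa_metrizable :: "'a topology \<Rightarrow> bool" where
  "weakly_kappa_metrizable X \<longleftrightarrow> (\<exists>d. weak_kappa_metric X d)"


section \<open>Skeletally generated spaces\<close>

definition skeletal_map :: "'a topology \<Rightarrow> 'b topology \<Rightarrow> ('a \<Rightarrow> 'b) \<Rightarrow> bool" where
  "skeletal_map X Y f \<longleftrightarrow> continuous_map X Y f \<and>
     (\<forall>U. openin X U \<and> U \<noteq> {} \<longrightarrow> Y interior_of (Y closure_of (f ` U)) \<noteq> {})"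

definition directed_order :: "'i set \<Rightarrow> 'i rel \<Rightarrow> bool" where
  "directed_order A r \<longleftrightarrow> A \<noteq> {} \<and> partial_order_on A r \<and>
     (\<forall>a \<in> A. \<forall>b \<in> A. \<exists>c \<in> A. (a, c) \<in> r \<and> (b, c) \<in> r)"

definition is_supremum :: "'i set \<Rightarrow> 'i rel \<Rightarrow> 'i set \<Rightarrow> 'i \<Rightarrow> bool" where
  "is_supremum A r C b \<longleftrightarrow> b \<in> A \<and> (\<forall>a \<in> C. (a, b) \<in> r) \<and>
     (\<forall>c \<in> A. (\<forall>a \<in> C. (a, c) \<in> r) \<longrightarrow> (b, c) \<in> r)"

definition sigma_complete :: "'i set \<Rightarrow> 'i rel \<Rightarrow> bool" where
  "sigma_complete A r \<longleftrightarrow>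
     (\<forall>C. C \<subseteq> A \<and> C \<noteq> {} \<and> countable C \<and> C \<in> Chains r \<longrightarrow> (\<exists>b. is_supremum A r C b))"

text \<open>For \<open>(a, b) \<in> r\<close>, i.e. \<open>a \<le> b\<close>, the bonding map from \<open>Y b\<close> to \<open>Y a\<close> is \<open>p b a\<close>.\<close>

definition inverse_system ::
  "'i set \<Rightarrow> 'i rel \<Rightarrow> ('i \<Rightarrow> 'b topology) \<Rightarrow> ('i \<Rightarrow> 'i \<Rightarrow> 'b \<Rightarrow> 'b) \<Rightarrow> bool" where
  "inverse_system A r Y p \<longleftrightarrow> directed_order A r \<and>
     (\<forall>(a, b) \<in> r. continuous_map (Y b) (Y a) (p b a)) \<and>
     (\<forall>a \<in> A. \<forall>y \<in> topspace (Y a). p a a y = y) \<and>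
     (\<forall>a b c. (a, b) \<in> r \<and> (b, c) \<in> r \<longrightarrow>
        (\<forall>y \<in> topspace (Y c). p b a (p c b y) = p c a y))"

definition inverse_limit ::
  "'i set \<Rightarrow> 'i rel \<Rightarrow> ('i \<Rightarrow> 'b topology) \<Rightarrow> ('i \<Rightarrow> 'i \<Rightarrow> 'b \<Rightarrow> 'b) \<Rightarrow> ('i \<Rightarrow> 'b) topology" where
  "inverse_limit A r Y p =
     subtopology (product_topology Y A) {x. \<forall>(a, b) \<in> r. p b a (x b) = x a}"

text \<open>\<open>skeletal_presentation X A r Y p\<close>: the given inverse system witnesses that \<open>X\<close> is skeletally
  generated. The limit of the sequence \<open>Y (s 0) \<leftarrow> Y (s 1) \<leftarrow> \<dots>\<close> is formed with all bonding
  maps \<open>p (s n) (s m)\<close> for \<open>m \<le> n\<close>, which are the composites of the consecutive ones.\<close>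

definition skeletal_presentation ::
  "'a topology \<Rightarrow> 'i set \<Rightarrow> 'i rel \<Rightarrow> ('i \<Rightarrow> 'b topology) \<Rightarrow> ('i \<Rightarrow> 'i \<Rightarrow> 'b \<Rightarrow> 'b) \<Rightarrow> bool" where
  "skeletal_presentation X A r Y p \<longleftrightarrow>
     inverse_system A r Y p \<and>
     (\<forall>a \<in> A. metrizable_space (Y a) \<and> separable_space (Y a)) \<and>
     (\<forall>(a, b) \<in> r. skeletal_map (Y b) (Y a) (p b a) \<and> p b a ` topspace (Y b) = topspace (Y a)) \<and>
     sigma_complete A r \<and>
     (\<forall>s b. range s \<subseteq> A \<and> (\<forall>n. (s n, s (Suc n)) \<in> r) \<and> is_supremum A r (range s) b \<longrightarrow>
        (let L = inverse_limit (UNIV :: nat set) {(m, n). m \<le> n} (\<lambda>n. Y (s n)) (\<lambda>n m. p (s n) (s m));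
             h = (\<lambda>y n. p b (s n) y)
         in embedding_map (Y b) L h \<and> L closure_of (h ` topspace (Y b)) = topspace L)) \<and>
     (\<exists>e. embedding_map X (inverse_limit A r Y p) e \<and>
        (\<forall>a \<in> A. (\<lambda>x. e x a) ` topspace X = topspace (Y a)))"

text \<open>HOL cannot quantify over the types carrying the index set and the spaces \<open>Y a\<close>, so large
  enough ones are fixed. Every separable metrizable space embeds in \<open>nat \<Rightarrow> real\<close>. The index set
  can be cut down to a subset of cardinality at most \<open>2 ^ |X|\<close> (or to a single point if \<open>X\<close> is
  finite): start with a set of that size whose projections generate the topology of \<open>X\<close>, and close
  it under upper bounds of pairs and suprema of countable chains.\<close>

definition skeletally_generated :: "'a topology \<Rightarrow> bool" where
  "skeletally_generated X \<longleftrightarrow>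
     (\<exists>(A :: ('a \<Rightarrow> real) set set) r (Y :: ('a \<Rightarrow> real) set \<Rightarrow> (nat \<Rightarrow> real) topology) p.
        skeletal_presentation X A r Y p)"

end

theory Submission
  imports Defs
begin

text \<open>Skeletally generated to weakly kappa-metrizable. Assign to each basic open set \<open>U\<close> of \<open>X\<close> some
  finite sets \<open>s\<close> of continuous functions, such that the sets where all \<open>h \<in> s\<close> are
  positive are together dense in \<open>U\<close>, and such that disjoint basic sets receive
  sets \<open>s\<close>, \<open>t\<close> with \<open>h \<in> s\<close> and \<open>-h \<in> t\<close> for some \<open>h\<close>. Then \<open>d(x, C)\<close> is the supremum of
  \<open>\<Prod>h\<in>s. max (h x) 0\<close> over all finite \<open>s\<close> which are in this way opposed to
  every set assigned to some \<open>U \<subseteq> C\<close>. As \<open>\<bar>h\<bar> \<le> 1/2\<close>, only sets \<open>s\<close> of bounded size matter,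
  and a compactness argument on these gives the continuity conditions. The assignment is constructed
  by induction on the cardinality of a directed set \<open>B\<close> of indices: an uncountable \<open>B\<close> is the union
  of a well-ordered chain of smaller directed sets, and an open set \<open>V\<close> appearing at stage \<open>j\<close> is
  labelled by \<open>s \<union> t\<close>, where \<open>s\<close> comes from stage \<open>j\<close> and \<open>t\<close> from an earlier \<open>U\<close> in which the
  projection of \<open>V\<close> is dense.

  Weakly kappa-metrizable to skeletally generated. Index the inverse system by the countable sets
  \<open>P\<close> of continuous functions that contain \<open>d(\<cdot>, cl W)\<close> for every \<open>W\<close> in the countable base
  belonging to \<open>P\<close>. If the image of some open \<open>U\<close> under the diagonal map \<open>f\<close> of \<open>P\<close> were nowhere
  dense, then its exterior would be the union of increasing basic sets with preimages \<open>W\<^sub>n\<close>, and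
  \<open>inf d(\<cdot>, cl W\<^sub>n)\<close> would be continuous, constant on the fibres of \<open>f\<close> and zero on a set
  with dense image, hence zero; but at some point of \<open>U\<close> it is at least
  \<open>d(\<cdot>, cl (\<Union>n. W\<^sub>n)) > 0\<close>.\<close>

section \<open>The height function of a family of labels\<close>

text \<open>Opposition is a certificate that two positivity sets are disjoint. It survives enlarging
  either label and, unlike disjointness itself, amounts for finite \<open>t\<close> to meeting a
  fixed finite set, which makes it pass to cluster points.\<close>

definition opposed :: "('a \<Rightarrow> real) set \<Rightarrow> ('a \<Rightarrow> real) set \<Rightarrow> bool" where
  "opposed s t \<longleftrightarrow> (\<exists>h\<in>s. (\<lambda>x. - h x) \<in> t)"

definition pos_set :: "'a topology \<Rightarrow> ('a \<Rightarrow> real) set \<Rightarrow> 'a set" where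
  "pos_set X s = {x \<in> topspace X. \<forall>h\<in>s. 0 < h x}"

definition bump :: "('a \<Rightarrow> real) set \<Rightarrow> 'a \<Rightarrow> real" where
  "bump s x = (\<Prod>h\<in>s. max (h x) 0)"

definition literals :: "'a topology \<Rightarrow> ('a \<Rightarrow> real) set" where
  "literals X = {h. continuous_map X euclideanreal h \<and> (\<forall>x\<in>topspace X. \<bar>h x\<bar> \<le> 1/2)}"

definition label :: "'a topology \<Rightarrow> ('a \<Rightarrow> real) set \<Rightarrow> bool" where
  "label X s \<longleftrightarrow> finite s \<and> s \<subseteq> literals X"

definition separators :: "'a topology \<Rightarrow> ('a \<Rightarrow> real) set set \<Rightarrow> ('a \<Rightarrow> real) set set" where
  "separators X T = {s. label X s \<and> (\<forall>t\<in>T. opposed s t)}"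

text \<open>The inserted 0 fixes the value when there are no separators, since \<open>Sup\<close> of
  the empty set of reals is unspecified. Bumps are nonnegative, so it never changes a nonempty
  supremum.\<close>

definition height :: "'a topology \<Rightarrow> ('a \<Rightarrow> real) set set \<Rightarrow> 'a \<Rightarrow> real" where
  "height X T x = Sup (insert 0 ((\<lambda>s. bump s x) ` separators X T))"

section \<open>Elementary facts on opposition, positivity sets and bumps\<close>

lemma opposed_sym: "opposed s t \<Longrightarrow> opposed t s"
  unfolding opposed_def by force

lemma opposed_mono: "opposed s t \<Longrightarrow> s \<subseteq> s' \<Longrightarrow> t \<subseteq> t' \<Longrightarrow> opposed s' t'"
  unfolding opposed_def by blast

lemma opposed_imp_disjoint: "opposed s t \<Longrightarrow> pos_set X s \<inter> pos_set X t = {}"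
  unfolding opposed_def pos_set_def by force

lemma label_Un: "label X s \<Longrightarrow> label X t \<Longrightarrow> label X (s \<union> t)"
  by (simp add: label_def)

lemma pos_set_Un: "pos_set X (s \<union> t) = pos_set X s \<inter> pos_set X t"
  by (auto simp: pos_set_def)

lemma continuous_map_bump:
  assumes "label X s"
  shows "continuous_map X euclideanreal (bump s)"
proof -
  have "continuous_map X euclideanreal (\<lambda>x. \<Prod>h\<in>s. max (h x) 0)"
    using assms
    by (intro continuous_map_prod continuous_map_real_max) (auto simp: label_def literals_def)
  then show ?thesis by (simp add: bump_def[abs_def])
qed

lemma bump_pos_iff:
  assumes "label X s" "x \<in> topspace X"
  shows "0 < bump s x \<longleftrightarrow> x \<in> pos_set X s"
proof
  assume "0 < bump s x"
  then have "max (h x) 0 \<noteq> 0" if "h \<in> s" for h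
    unfolding bump_def using assms(1) that prod_zero[of s "\<lambda>h. max (h x) 0"]
    by (metis label_def less_irrefl)
  then show "x \<in> pos_set X s" using assms(2) unfolding pos_set_def max_def by (smt (verit) mem_Collect_eq)
next
  assume "x \<in> pos_set X s"
  then show "0 < bump s x"
    unfolding bump_def pos_set_def by (intro prod_pos) auto
qed

lemma openin_pos_set:
  assumes "label X s"
  shows "openin X (pos_set X s)"
proof -
  have "pos_set X s = {x \<in> topspace X. 0 < bump s x}"
    using bump_pos_iff[OF assms] by (auto simp: pos_set_def)
  then show ?thesis
    using continuous_map_bump[OF assms] by (simp add: continuous_map_upper_lower_semicontinuous_lt)
qed

lemma bump_nonneg: "0 \<le> bump s x"
  unfolding bump_def by (rule prod_nonneg) auto

lemma bump_le_power:
  assumes "label X s" "x \<in> topspace X"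
  shows "bump s x \<le> (1/2) ^ card s"
proof -
  have "(\<Prod>h\<in>s. max (h x) 0) \<le> (\<Prod>h\<in>s. 1/2)"
    using assms by (intro prod_mono) (force simp: label_def literals_def)
  then show ?thesis by (simp add: bump_def)
qed

lemma bump_le_1:
  assumes "label X s" "x \<in> topspace X"
  shows "bump s x \<le> 1"
  using bump_le_power[OF assms] power_le_one[of "1/2::real" "card s"] by simp

text \<open>The factors belonging to \<open>s - t\<close> lie in the unit interval. Passing to a
  smaller label thus keeps every lower bound on the bump.\<close>

lemma bump_antimono:
  assumes "label X s" "x \<in> topspace X" "t \<subseteq> s"
  shows "bump s x \<le> bump t x"
proof -
  have "bump s x = bump t x * bump (s - t) x"
    unfolding bump_def using assms prod.subset_diff[of t s "\<lambda>h. max (h x) 0"]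
    by (simp add: label_def mult.commute)
  also have "\<dots> \<le> bump t x * 1"
    using assms bump_le_1[of X "s - t" x] bump_nonneg[of t x]
    by (intro mult_left_mono) (auto simp: label_def)
  finally show ?thesis by simp
qed

text \<open>A weak form of compactness of the space of sets of at most \<open>n\<close> elements: a maximal set
  that extends into all members of the filter base is a cluster point.\<close>

lemma bounded_sets_cluster:
  fixes \<G> :: "'l set set set"
  assumes ne: "\<G> \<noteq> {}" "\<And>G. G \<in> \<G> \<Longrightarrow> G \<noteq> {}"
    and dir: "\<And>G H. G \<in> \<G> \<Longrightarrow> H \<in> \<G> \<Longrightarrow> \<exists>K\<in>\<G>. K \<subseteq> G \<inter> H"
    and bound: "\<And>G s. G \<in> \<G> \<Longrightarrow> s \<in> G \<Longrightarrow> finite s \<and> card s \<le> n"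
  obtains c where "\<And>G. G \<in> \<G> \<Longrightarrow> \<exists>s\<in>G. c \<subseteq> s"
    and "\<And>R G. finite R \<Longrightarrow> G \<in> \<G> \<Longrightarrow> \<forall>s\<in>G. s \<inter> R \<noteq> {} \<Longrightarrow> c \<inter> R \<noteq> {}"
proof -
  define Q where "Q c \<longleftrightarrow> (\<forall>G\<in>\<G>. \<exists>s\<in>G. c \<subseteq> s)" for c
  have "Q {}" using ne by (auto simp: Q_def)
  moreover have Qb: "finite c \<and> card c \<le> n" if "Q c" for c
  proof -
    obtain G where "G \<in> \<G>" using ne(1) by blast
    then obtain s where "s \<in> G" "c \<subseteq> s" using \<open>Q c\<close> by (auto simp: Q_def)
    then show ?thesis
      using bound[OF \<open>G \<in> \<G>\<close>, of s] card_mono[of s c] finite_subset[of c s] by auto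
  qed
  \<comment> \<open>The sets extending into every member of \<open>\<G>\<close> have at most
    \<open>n\<close> elements, so one of greatest cardinality exists.\<close>
  ultimately have "\<exists>c. Q c \<and> (\<forall>c'. Q c' \<longrightarrow> card c' \<le> card c)"
    by (intro ex_has_greatest_nat[of Q "{}" card "Suc n"]) (auto simp: less_Suc_eq_le)
  then obtain c where c: "Q c" "\<And>c'. Q c' \<Longrightarrow> card c' \<le> card c" by blast
  have "c \<inter> R \<noteq> {}" if R: "finite R" "G \<in> \<G>" "\<forall>s\<in>G. s \<inter> R \<noteq> {}" for R G
  proof
    assume disj: "c \<inter> R = {}"
    \<comment> \<open>By maximality every \<open>l\<close> in \<open>R\<close> comes with a member
      \<open>H l\<close> into which \<open>insert l c\<close> does not extend. A common lower bound
      of \<open>G\<close> and these finitely many members still contains an extension of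
      \<open>c\<close>; that extension meets \<open>R\<close> in some \<open>l\<close>, against the
      choice of \<open>H l\<close>.\<close>
    have "\<exists>H. H \<in> \<G> \<and> (\<forall>s\<in>H. \<not> insert l c \<subseteq> s)" if "l \<in> R" for l
    proof -
      have "l \<notin> c" using disj that by blast
      then have "card (insert l c) > card c" using Qb[OF c(1)] by simp
      then have "\<not> Q (insert l c)" using c(2)[of "insert l c"] by linarith
      then show ?thesis unfolding Q_def by blast
    qed
    then have "\<forall>l\<in>R. \<exists>H. H \<in> \<G> \<and> (\<forall>s\<in>H. \<not> insert l c \<subseteq> s)" by blast
    then obtain H where "\<forall>l\<in>R. H l \<in> \<G> \<and> (\<forall>s\<in>H l. \<not> insert l c \<subseteq> s)"
      by (rule bchoice[THEN exE])
    then have H: "\<And>l. l \<in> R \<Longrightarrow> H l \<in> \<G>" "\<And>l s. l \<in> R \<Longrightarrow> s \<in> H l \<Longrightarrow> \<not> insert l c \<subseteq> s"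
      by blast+
    have "\<exists>K\<in>\<G>. K \<subseteq> G \<and> (\<forall>l\<in>R'. K \<subseteq> H l)" if "finite R'" "R' \<subseteq> R" for R'
      using that
    proof (induction R')
      case empty
      show ?case using R(2) by blast
    next
      case (insert l R')
      then obtain K where K: "K \<in> \<G>" "K \<subseteq> G" "\<forall>l\<in>R'. K \<subseteq> H l" by blast
      obtain K' where "K' \<in> \<G>" "K' \<subseteq> K \<inter> H l"
        using dir[OF K(1) H(1)[of l]] insert.prems by blast
      with K show ?case by (intro bexI[of _ K']) auto
    qed
    from this[OF R(1) order.refl] obtain K where K: "K \<in> \<G>" "K \<subseteq> G" "\<forall>l\<in>R. K \<subseteq> H l"
      by blast
    then obtain s where s: "s \<in> K" "c \<subseteq> s" using c(1) unfolding Q_def by blast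
    then have "s \<in> G" using K(2) by blast
    then have "s \<inter> R \<noteq> {}" using R(3) by blast
    then obtain l where l: "l \<in> s" "l \<in> R" by blast
    then have "s \<in> H l" using s(1) K(3) by blast
    from H(2)[OF l(2) this] show False using s(2) l(1) by blast
  qed
  moreover have "\<exists>s\<in>G. c \<subseteq> s" if "G \<in> \<G>" for G
    using c(1) that unfolding Q_def by blast
  ultimately show thesis by (rule that[rotated])
qed

section \<open>Continuity of the height function and infima along chains\<close>

lemma height_bdd: "x \<in> topspace X \<Longrightarrow> bdd_above (insert 0 ((\<lambda>s. bump s x) ` separators X T))"
  unfolding bdd_above_insert
  by (rule bdd_aboveI[of _ 1]) (auto simp: separators_def intro: bump_le_1)

lemma height_nonneg: "x \<in> topspace X \<Longrightarrow> 0 \<le> height X T x"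
  unfolding height_def by (rule cSup_upper[OF _ height_bdd]) auto

lemma height_upper: "x \<in> topspace X \<Longrightarrow> s \<in> separators X T \<Longrightarrow> bump s x \<le> height X T x"
  unfolding height_def by (rule cSup_upper[OF _ height_bdd]) auto

lemma less_height_iff:
  assumes "x \<in> topspace X" "0 \<le> a"
  shows "a < height X T x \<longleftrightarrow> (\<exists>s\<in>separators X T. a < bump s x)"
  unfolding height_def using assms height_bdd[OF assms(1), of T]
  by (subst less_cSup_iff) auto

lemma height_antimono: "x \<in> topspace X \<Longrightarrow> T \<subseteq> T' \<Longrightarrow> height X T' x \<le> height X T x"
  unfolding height_def by (rule cSup_subset_mono[OF _ height_bdd]) (auto simp: separators_def)

text \<open>Opposition to \<open>t\<close> means meeting the finite set of negatives of \<open>t\<close>, so it passes to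
  cluster points.\<close>

lemma opposed_cluster:
  fixes G :: "'j \<Rightarrow> ('a \<Rightarrow> real) set set"
  assumes "J \<noteq> {}" and ne: "\<And>j. j \<in> J \<Longrightarrow> G j \<noteq> {}"
    and dir: "\<And>j k. j \<in> J \<Longrightarrow> k \<in> J \<Longrightarrow> \<exists>l\<in>J. G l \<subseteq> G j \<inter> G k"
    and bound: "\<And>j s. j \<in> J \<Longrightarrow> s \<in> G j \<Longrightarrow> label X s \<and> (\<exists>x\<in>topspace X. a < bump s x)"
    and "0 < a"
    and T: "\<And>t. t \<in> T \<Longrightarrow> finite t \<and> (\<exists>j\<in>J. \<forall>s\<in>G j. opposed s t)"
  shows "\<exists>c\<in>separators X T. \<forall>j\<in>J. \<exists>s\<in>G j. c \<subseteq> s"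
proof -
  \<comment> \<open>Bumps of labels with \<open>n\<close> or more elements are at most
    \<open>(1/2) ^ n\<close>, hence below \<open>a\<close>; this bounds the cardinality of all
    labels in sight.\<close>
  obtain n where n: "(1/2) ^ n < a"
    using real_arch_pow_inv[of a "1/2"] \<open>0 < a\<close> by auto
  have fb: "finite s \<and> card s \<le> n" if "H \<in> G ` J" "s \<in> H" for H s
  proof -
    obtain x where x: "label X s" "x \<in> topspace X" "a < bump s x"
      using \<open>H \<in> G ` J\<close> \<open>s \<in> H\<close> bound by (metis imageE)
    then have "(1/2::real) ^ n < (1/2) ^ card s" using n bump_le_power[OF x(1,2)] by linarith
    then have "card s < n" by (subst (asm) power_strict_decreasing_iff) auto
    then show ?thesis using x by (simp add: label_def)
  qed
  obtain c where c: "\<And>H. H \<in> G ` J \<Longrightarrow> \<exists>s\<in>H. c \<subseteq> s"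
    "\<And>R H. finite R \<Longrightarrow> H \<in> G ` J \<Longrightarrow> \<forall>s\<in>H. s \<inter> R \<noteq> {} \<Longrightarrow> c \<inter> R \<noteq> {}"
  proof (rule bounded_sets_cluster[of "G ` J" n])
    show "\<exists>K\<in>G ` J. K \<subseteq> H \<inter> H'" if "H \<in> G ` J" "H' \<in> G ` J" for H H'
      using that dir by (metis (no_types, lifting) image_iff)
  qed (use \<open>J \<noteq> {}\<close> ne fb in auto)
  obtain j s where "j \<in> J" "s \<in> G j" "c \<subseteq> s" using c(1) \<open>J \<noteq> {}\<close> by blast
  then have "label X c" using bound unfolding label_def by (meson finite_subset subset_trans)
  moreover have "opposed c t" if "t \<in> T" for t
  proof -
    let ?R = "(\<lambda>h x. - h x) ` t"
    obtain j where j: "j \<in> J" "\<forall>s\<in>G j. opposed s t" using T[OF \<open>t \<in> T\<close>] by blast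
    have "s \<inter> ?R \<noteq> {}" if "opposed s t" for s
    proof -
      obtain h where h: "h \<in> s" "(\<lambda>x. - h x) \<in> t" using \<open>opposed s t\<close> by (auto simp: opposed_def)
      then have "h \<in> ?R" by (intro image_eqI[of _ _ "\<lambda>x. - h x"]) auto
      then show ?thesis using h by blast
    qed
    then have "c \<inter> ?R \<noteq> {}" using T[OF that] j by (intro c(2)[of ?R "G j"]) auto
    then obtain h where "h \<in> t" "(\<lambda>x. - h x) \<in> c" by auto
    then show ?thesis unfolding opposed_def by (intro bexI[of _ "\<lambda>x. - h x"]) auto
  qed
  ultimately have "c \<in> separators X T" by (auto simp: separators_def)
  then show ?thesis using c(1) by blast
qed

text \<open>Separators shrink along the chain, so for a level \<open>a\<close> strictly between the
  two sides the separators with bump above \<open>a\<close> at \<open>x\<close> form a filter base.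
  A cluster label separates the whole union, and its bump at \<open>x\<close> exceeds
  \<open>a\<close> because it lies inside labels of that kind.\<close>

lemma INF_height_chain:
  assumes x: "x \<in> topspace X" and "\<T> \<noteq> {}"
    and chain: "\<And>T T'. T \<in> \<T> \<Longrightarrow> T' \<in> \<T> \<Longrightarrow> T \<subseteq> T' \<or> T' \<subseteq> T"
    and fin: "\<And>T t. T \<in> \<T> \<Longrightarrow> t \<in> T \<Longrightarrow> finite t"
  shows "(INF T\<in>\<T>. height X T x) = height X (\<Union>\<T>) x"
proof (rule antisym)
  show "height X (\<Union>\<T>) x \<le> (INF T\<in>\<T>. height X T x)"
    using assms by (intro cINF_greatest height_antimono) auto
  show "(INF T\<in>\<T>. height X T x) \<le> height X (\<Union>\<T>) x"
  proof (rule ccontr)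
    assume "\<not> ?thesis"
    then obtain a where a: "height X (\<Union>\<T>) x < a" "a < (INF T\<in>\<T>. height X T x)"
      using dense not_le by blast
    then have "0 < a" using height_nonneg[OF x, of "\<Union>\<T>"] by linarith
    define G where "G T = {s \<in> separators X T. a < bump s x}" for T
    have 1: "G T \<noteq> {}" if "T \<in> \<T>" for T
    proof -
      have "bdd_below ((\<lambda>T. height X T x) ` \<T>)"
        using height_nonneg[OF x] by (intro bdd_belowI[of _ 0]) auto
      then have "a < height X T x" using a(2) that cINF_lower less_le_trans by metis
      then show ?thesis using less_height_iff[OF x, of a T] \<open>0 < a\<close> by (auto simp: G_def)
    qed
    have 2: "\<exists>U\<in>\<T>. G U \<subseteq> G T \<inter> G T'" if "T \<in> \<T>" "T' \<in> \<T>" for T T'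
      using chain[OF that] that by (auto simp: G_def separators_def)
    have 3: "label X s \<and> (\<exists>x\<in>topspace X. a < bump s x)" if "s \<in> G T" for s T
      using that x by (auto simp: G_def separators_def)
    have 4: "finite t \<and> (\<exists>T\<in>\<T>. \<forall>s\<in>G T. opposed s t)" if "t \<in> \<Union>\<T>" for t
      using that fin by (fastforce simp: G_def separators_def)
    have "\<exists>c\<in>separators X (\<Union>\<T>). \<forall>T\<in>\<T>. \<exists>s\<in>G T. c \<subseteq> s"
      by (rule opposed_cluster[OF \<open>\<T> \<noteq> {}\<close> 1 2 3 \<open>0 < a\<close> 4])
    then obtain c where c: "c \<in> separators X (\<Union>\<T>)" "\<And>T. T \<in> \<T> \<Longrightarrow> \<exists>s\<in>G T. c \<subseteq> s"
      by auto
    then obtain s where "label X s" "a < bump s x" "c \<subseteq> s"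
      using \<open>\<T> \<noteq> {}\<close> by (fastforce simp: G_def separators_def)
    then have "a < bump c x" using bump_antimono[of X s x c] x by auto
    then show False using height_upper[OF x c(1)] a(1) by linarith
  qed
qed

text \<open>Lower semicontinuity is automatic for a supremum of continuous functions. For upper
  semicontinuity at \<open>x\<close>, the separators with bump above \<open>a\<close> somewhere in a
  neighbourhood of \<open>x\<close> are clustered along the neighbourhood filter.\<close>

lemma continuous_map_height:
  assumes fin: "\<And>t. t \<in> T \<Longrightarrow> finite t"
  shows "continuous_map X euclideanreal (height X T)"
  unfolding continuous_map_upper_lower_semicontinuous_lt
proof (intro allI conjI)
  fix a :: real
  show "openin X {x \<in> topspace X. a < height X T x}"
  proof (cases "a < 0")
    case True
    then have "{x \<in> topspace X. a < height X T x} = topspace X"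
      using height_nonneg[of _ X T] by (auto intro: less_le_trans)
    then show ?thesis by simp
  next
    case False
    then have "{x \<in> topspace X. a < height X T x} =
      (\<Union>s\<in>separators X T. {x \<in> topspace X. a < bump s x})"
      using less_height_iff[of _ X a T] by auto
    moreover have "openin X {x \<in> topspace X. a < bump s x}" if "s \<in> separators X T" for s
      using that continuous_map_bump[of X s]
      by (auto simp: separators_def continuous_map_upper_lower_semicontinuous_lt)
    ultimately show ?thesis by auto
  qed
next
  fix b :: real
  show "openin X {x \<in> topspace X. height X T x < b}"
  proof (subst openin_subopen, safe)
    fix x assume x: "x \<in> topspace X" "height X T x < b"
    obtain a where a: "height X T x < a" "a < b" using x dense by blast
    then have "0 < a" using height_nonneg[OF x(1), of T] by linarith
    show "\<exists>N. openin X N \<and> x \<in> N \<and> N \<subseteq> {x \<in> topspace X. height X T x < b}"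
    proof (rule ccontr)
      assume neg: "\<not> ?thesis"
      define G where "G N = {s \<in> separators X T. \<exists>y\<in>N. a < bump s y}" for N
      define \<N> where "\<N> = {N. openin X N \<and> x \<in> N}"
      have 1: "G N \<noteq> {}" if "N \<in> \<N>" for N
      proof -
        have N: "openin X N" "x \<in> N" using that by (auto simp: \<N>_def)
        then have "\<not> N \<subseteq> {x \<in> topspace X. height X T x < b}" using neg by blast
        then obtain y where y: "y \<in> N" "y \<in> topspace X" "\<not> height X T y < b"
          using openin_subset[OF N(1)] by blast
        then have "a < height X T y" using a by linarith
        then show ?thesis using less_height_iff[OF y(2), of a T] \<open>0 < a\<close> y(1) unfolding G_def by fastforce
      qed
      have 2: "\<exists>K\<in>\<N>. G K \<subseteq> G N \<inter> G N'" if "N \<in> \<N>" "N' \<in> \<N>" for N N'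
        using that by (intro bexI[of _ "N \<inter> N'"]) (auto simp: G_def \<N>_def)
      have "topspace X \<in> \<N>" using x by (auto simp: \<N>_def)
      have 3: "label X s \<and> (\<exists>x\<in>topspace X. a < bump s x)" if "N \<in> \<N>" "s \<in> G N" for N s
        using that openin_subset[of X N] by (auto simp: G_def \<N>_def separators_def)
      have 4: "finite t \<and> (\<exists>N\<in>\<N>. \<forall>s\<in>G N. opposed s t)" if "t \<in> T" for t
        using that fin \<open>topspace X \<in> \<N>\<close> by (fastforce simp: G_def separators_def)
      have "\<N> \<noteq> {}" using \<open>topspace X \<in> \<N>\<close> by blast
      then have "\<exists>c\<in>separators X T. \<forall>N\<in>\<N>. \<exists>s\<in>G N. c \<subseteq> s"
        by (rule opposed_cluster[OF _ 1 2 3 \<open>0 < a\<close> 4])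
      then obtain c where c: "c \<in> separators X T" "\<And>N. N \<in> \<N> \<Longrightarrow> \<exists>s\<in>G N. c \<subseteq> s"
        by auto
      \<comment> \<open>The cluster label has bump below \<open>a\<close> at \<open>x\<close>, hence
        on a neighbourhood. A larger label with bump above \<open>a\<close> at a point of that
        neighbourhood contradicts \<open>bump_antimono\<close>.\<close>
      let ?N0 = "{y \<in> topspace X. bump c y < a}"
      have "openin X ?N0"
        using c(1) continuous_map_bump[of X c]
        by (auto simp: separators_def continuous_map_upper_lower_semicontinuous_lt)
      moreover have "x \<in> ?N0" using height_upper[OF x(1) c(1)] a x by auto
      ultimately have "?N0 \<in> \<N>" by (simp add: \<N>_def)
      from c(2)[OF this] obtain s y
        where s: "s \<in> separators X T" "c \<subseteq> s" "y \<in> ?N0" "a < bump s y"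
        unfolding G_def by blast
      then have "bump s y \<le> bump c y" using bump_antimono[of X s y c] by (auto simp: separators_def)
      then show False using s by auto
    qed
  qed
qed

section \<open>Resolvable families of open sets\<close>

text \<open>One set may carry many labels, whose positivity sets together are dense in it. Only the
  density clause refers to \<open>\<B>\<close>, so a resolution also serves every subfamily.\<close>

definition resolution :: "'a topology \<Rightarrow> 'a set set \<Rightarrow> ('a set \<times> ('a \<Rightarrow> real) set) set \<Rightarrow> bool" where
  "resolution X \<B> E \<longleftrightarrow>
     (\<forall>U s. (U, s) \<in> E \<longrightarrow> label X s) \<and>
     (\<forall>U s V t. (U, s) \<in> E \<and> (V, t) \<in> E \<and> U \<inter> V = {} \<longrightarrow> opposed s t) \<and>
     (\<forall>U\<in>\<B>. \<forall>W. openin X W \<and> W \<noteq> {} \<and> W \<subseteq> U \<longrightarrow>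
        (\<exists>s. (U, s) \<in> E \<and> W \<inter> pos_set X s \<noteq> {}))"

definition resolvable :: "'a topology \<Rightarrow> 'a set set \<Rightarrow> bool" where
  "resolvable X \<B> \<longleftrightarrow> (\<exists>E. resolution X \<B> E)"

lemma resolvableE:
  assumes "resolvable X \<B>"
  obtains E where "\<And>U s. (U, s) \<in> E \<Longrightarrow> label X s"
    and "\<And>U s V t. (U, s) \<in> E \<Longrightarrow> (V, t) \<in> E \<Longrightarrow> U \<inter> V = {} \<Longrightarrow> opposed s t"
    and "\<And>U W. U \<in> \<B> \<Longrightarrow> openin X W \<Longrightarrow> W \<noteq> {} \<Longrightarrow> W \<subseteq> U \<Longrightarrow>
        \<exists>s. (U, s) \<in> E \<and> W \<inter> pos_set X s \<noteq> {}"
proof -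
  obtain E where E: "\<forall>U s. (U, s) \<in> E \<longrightarrow> label X s"
    "\<forall>U s V t. (U, s) \<in> E \<and> (V, t) \<in> E \<and> U \<inter> V = {} \<longrightarrow> opposed s t"
    "\<forall>U\<in>\<B>. \<forall>W. openin X W \<and> W \<noteq> {} \<and> W \<subseteq> U \<longrightarrow> (\<exists>s. (U, s) \<in> E \<and> W \<inter> pos_set X s \<noteq> {})"
    using assms unfolding resolvable_def resolution_def by (elim exE conjE)
  show thesis
    by (rule that[of E]) (use E in \<open>simp_all\<close>)
qed

lemma resolvableI:
  assumes "\<And>U s. (U, s) \<in> E \<Longrightarrow> label X s"
    and "\<And>U s V t. (U, s) \<in> E \<Longrightarrow> (V, t) \<in> E \<Longrightarrow> U \<inter> V = {} \<Longrightarrow> opposed s t"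
    and "\<And>U W. U \<in> \<B> \<Longrightarrow> openin X W \<Longrightarrow> W \<noteq> {} \<Longrightarrow> W \<subseteq> U \<Longrightarrow>
        \<exists>s. (U, s) \<in> E \<and> W \<inter> pos_set X s \<noteq> {}"
  shows "resolvable X \<B>"
  unfolding resolvable_def resolution_def
  apply (rule exI[of _ E])
  apply (intro conjI)
  using assms(1) apply blast
  using assms(2) apply blast
  using assms(3) apply blast
  done

lemma resolvable_subset:
  assumes "resolvable X \<B>" "\<A> \<subseteq> \<B>"
  shows "resolvable X \<A>"
proof (rule resolvableE[OF assms(1)])
  fix E
  assume E: "\<And>U s. (U, s) \<in> E \<Longrightarrow> label X s"
    "\<And>U s V t. (U, s) \<in> E \<Longrightarrow> (V, t) \<in> E \<Longrightarrow> U \<inter> V = {} \<Longrightarrow> opposed s t"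
    "\<And>U W. U \<in> \<B> \<Longrightarrow> openin X W \<Longrightarrow> W \<noteq> {} \<Longrightarrow> W \<subseteq> U \<Longrightarrow>
        \<exists>s. (U, s) \<in> E \<and> W \<inter> pos_set X s \<noteq> {}"
  show ?thesis
    by (rule resolvableI[of E, OF E(1,2) E(3)[OF subsetD[OF assms(2)]]])
qed

text \<open>With \<open>d x C = height X (T C) x\<close>, K2 is antitonicity of the height and K3
  its continuity. For K4 the families \<open>T (F i)\<close> form a chain, and the infimum is the
  height of their union, which is continuous. K1 is the interplay of opposition and density in the
  two facts \<open>zero\<close> and \<open>pos\<close>.\<close>

lemma resolvable_imp_weakly_kappa_metrizable:
  assumes "resolvable X \<B>"
    and base: "\<And>W. openin X W \<Longrightarrow> W \<noteq> {} \<Longrightarrow> \<exists>U\<in>\<B>. openin X U \<and> U \<noteq> {} \<and> U \<subseteq> W"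
  shows "weakly_kappa_metrizable X"
proof -
  obtain E where lab: "\<And>U s. (U, s) \<in> E \<Longrightarrow> label X s"
    and opp: "\<And>U s V t. (U, s) \<in> E \<Longrightarrow> (V, t) \<in> E \<Longrightarrow> U \<inter> V = {} \<Longrightarrow> opposed s t"
    and den: "\<And>U W. U \<in> \<B> \<Longrightarrow> openin X W \<Longrightarrow> W \<noteq> {} \<Longrightarrow> W \<subseteq> U \<Longrightarrow>
        \<exists>s. (U, s) \<in> E \<and> W \<inter> pos_set X s \<noteq> {}"
    by (rule resolvableE[OF assms(1)]) (rule that)
  define T where "T C = {t. \<exists>U. (U, t) \<in> E \<and> U \<subseteq> C}" for C
  define d where "d x C = height X (T C) x" for x C
  have T_mono: "T C \<subseteq> T C'" if "C \<subseteq> C'" for C C' using that by (auto simp: T_def)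
  have T_fin: "finite t" if "t \<in> T C" for t C using that lab by (auto simp: T_def label_def)
  have cont: "continuous_map X euclideanreal (\<lambda>x. d x C)" for C
    unfolding d_def using continuous_map_height[of "T C" X] T_fin by blast
  \<comment> \<open>A separator positive at \<open>x\<close> is positive on a nonempty open part of
    \<open>G\<close>, hence on a basic \<open>U\<close> inside \<open>C\<close>. Some label of
    \<open>U\<close> belongs to \<open>T C\<close> and is positive at a point of \<open>U\<close>,
    where the opposed separator is positive too.\<close>
  have zero: "\<not> 0 < d x C" if C: "C \<in> regularly_closed X" and x: "x \<in> C" for x C
  proof
    assume "0 < d x C"
    obtain G where G: "openin X G" "C = X closure_of G"
      using C by (auto simp: regularly_closed_def)
    then have xX: "x \<in> topspace X" using x by (simp add: in_closure_of)
    obtain s where s: "label X s" "\<And>t. t \<in> T C \<Longrightarrow> opposed s t" "0 < bump s x"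
      using \<open>0 < d x C\<close> unfolding d_def less_height_iff[OF xX order.refl] separators_def by blast
    have "x \<in> pos_set X s" using s bump_pos_iff[OF _ xX] by blast
    moreover have op: "openin X (pos_set X s)" using s openin_pos_set by blast
    ultimately have "pos_set X s \<inter> G \<noteq> {}"
      using x G(2) by (auto simp: in_closure_of)
    moreover have "openin X (pos_set X s \<inter> G)" using op G by blast
    ultimately obtain U where U: "U \<in> \<B>" "openin X U" "U \<noteq> {}" "U \<subseteq> pos_set X s \<inter> G"
      using base by blast
    obtain t where t: "(U, t) \<in> E" "U \<inter> pos_set X t \<noteq> {}" using den[OF U(1-3)] by blast
    have "G \<subseteq> C" using G closure_of_subset openin_subset by metis
    then have "U \<subseteq> C" using U(4) by blast
    then have "t \<in> T C" using t(1) unfolding T_def by blast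
    then have "pos_set X s \<inter> pos_set X t = {}" by (rule opposed_imp_disjoint[OF s(2)])
    then show False using t(2) U(4) by blast
  qed
  \<comment> \<open>A basic set inside \<open>W\<close> is disjoint from every subset of
    \<open>C\<close>, so each of its labels is itself a separator of \<open>T C\<close>.\<close>
  have pos: "{x \<in> topspace X. 0 < d x C} \<inter> W \<noteq> {}"
    if W: "openin X W" "W \<noteq> {}" "W \<inter> C = {}" for C W
  proof -
    obtain U where U: "U \<in> \<B>" "openin X U" "U \<noteq> {}" "U \<subseteq> W" using base W by blast
    obtain s where s: "(U, s) \<in> E" "U \<inter> pos_set X s \<noteq> {}" using den[OF U(1-3)] by blast
    obtain x where x: "x \<in> U" "x \<in> pos_set X s" using s by blast
    then have xX: "x \<in> topspace X" by (auto simp: pos_set_def)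
    have "opposed s t" if "t \<in> T C" for t
    proof -
      obtain U' where "(U', t) \<in> E" "U' \<subseteq> C" using \<open>t \<in> T C\<close> by (auto simp: T_def)
      moreover have "U \<inter> U' = {}" using \<open>U' \<subseteq> C\<close> U(4) W(3) by blast
      ultimately show ?thesis using opp[OF s(1)] by blast
    qed
    then have "s \<in> separators X (T C)" using lab[OF s(1)] by (auto simp: separators_def)
    moreover have "0 < bump s x" using bump_pos_iff[OF lab[OF s(1)] xX] x by blast
    ultimately have "0 < d x C" using height_upper[OF xX, of s "T C"] unfolding d_def by linarith
    then show ?thesis using x xX U by blast
  qed
  have "weak_kappa_metric X d"
    unfolding weak_kappa_metric_def
  proof (intro conjI)
    show "\<forall>x\<in>topspace X. \<forall>C\<in>regularly_closed X. 0 \<le> d x C"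
      by (simp add: d_def height_nonneg)
    show "\<forall>C\<in>regularly_closed X. \<exists>V. openin (subtopology X (topspace X - C)) V \<and>
        subtopology X (topspace X - C) closure_of V = topspace X - C \<and>
        (\<forall>x\<in>topspace X. (0 < d x C) = (x \<in> V))"
    proof
      fix C assume C: "C \<in> regularly_closed X"
      let ?S = "topspace X - C" and ?V = "{x \<in> topspace X. 0 < d x C}"
      have "closedin X C" using C by (auto simp: regularly_closed_def)
      then have "openin X ?S" by blast
      have "openin X ?V"
        using cont[of C] unfolding continuous_map_upper_lower_semicontinuous_lt by blast
      moreover have "?V \<subseteq> ?S" using zero[OF C] by blast
      ultimately have f1: "openin (subtopology X ?S) ?V"
        unfolding openin_open_subtopology[OF \<open>openin X ?S\<close>] by (rule conjI)
      have f2: "subtopology X ?S closure_of ?V = ?S"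
      proof -
        have "?V \<inter> W \<noteq> {}" if "openin (subtopology X ?S) W" "W \<noteq> {}" for W
        proof -
          have "openin X W" "W \<subseteq> ?S"
            using that(1) unfolding openin_open_subtopology[OF \<open>openin X ?S\<close>] by simp_all
          moreover have "W \<inter> C = {}" using \<open>W \<subseteq> ?S\<close> by blast
          ultimately show ?thesis using pos[of W C] \<open>W \<noteq> {}\<close> by blast
        qed
        then have "subtopology X ?S closure_of ?V = topspace (subtopology X ?S)"
          unfolding dense_intersects_open by blast
        then show ?thesis unfolding topspace_subtopology by blast
      qed
      show "\<exists>V. openin (subtopology X ?S) V \<and> subtopology X ?S closure_of V = ?S \<and>
          (\<forall>x\<in>topspace X. (0 < d x C) = (x \<in> V))"
        by (intro exI[of _ ?V] conjI f1 f2) blast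
    qed
    show "\<forall>C\<in>regularly_closed X. \<forall>C'\<in>regularly_closed X. C \<subseteq> C' \<longrightarrow>
        (\<forall>x\<in>topspace X. d x C' \<le> d x C)"
      unfolding d_def by (intro ballI impI height_antimono T_mono)
    show "\<forall>C\<in>regularly_closed X. continuous_map X euclideanreal (\<lambda>x. d x C)"
      using cont by blast
    show "\<forall>(I :: 'a set set) r F. I \<noteq> {} \<and> well_order_on I r \<and>
        (\<forall>i\<in>I. F i \<in> regularly_closed X) \<and> (\<forall>(i, j)\<in>r. F i \<subseteq> F j) \<longrightarrow>
        continuous_map X euclideanreal (\<lambda>x. INF i\<in>I. d x (F i))"
    proof (intro allI impI, elim conjE)
      fix I :: "'a set set" and r and F :: "'a set \<Rightarrow> 'a set"
      assume I: "I \<noteq> {}" "well_order_on I r" "\<forall>(i, j)\<in>r. F i \<subseteq> F j"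
      let ?\<T> = "(\<lambda>i. T (F i)) ` I"
      have tot: "(i, j) \<in> r \<or> (j, i) \<in> r" if "i \<in> I" "j \<in> I" for i j
        using I(2) that unfolding well_order_on_def linear_order_on_def partial_order_on_def
          preorder_on_def total_on_def refl_on_def by metis
      have chain: "S \<subseteq> S' \<or> S' \<subseteq> S" if S: "S \<in> ?\<T>" "S' \<in> ?\<T>" for S S'
      proof -
        obtain i j where "i \<in> I" "j \<in> I" "S = T (F i)" "S' = T (F j)" using S by blast
        moreover have "F i \<subseteq> F j \<or> F j \<subseteq> F i"
          using tot[OF \<open>i \<in> I\<close> \<open>j \<in> I\<close>] I(3) by blast
        ultimately show ?thesis using T_mono[of "F i" "F j"] T_mono[of "F j" "F i"] by blast
      qed
      have eq: "(INF i\<in>I. d x (F i)) = height X (\<Union>?\<T>) x" if x: "x \<in> topspace X" for x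
      proof -
        have "(INF S\<in>?\<T>. height X S x) = height X (\<Union>?\<T>) x"
        proof (rule INF_height_chain[OF x _ chain])
          show "?\<T> \<noteq> {}" using I(1) by simp
          show "finite t" if "S \<in> ?\<T>" "t \<in> S" for S t using that T_fin by blast
        qed
        then show ?thesis unfolding d_def image_image .
      qed
      have "continuous_map X euclideanreal (height X (\<Union>?\<T>))"
        by (rule continuous_map_height) (use T_fin in blast)
      then show "continuous_map X euclideanreal (\<lambda>x. INF i\<in>I. d x (F i))"
        by (rule continuous_map_eq) (simp add: eq)
    qed
  qed
  then show ?thesis by (auto simp: weakly_kappa_metrizable_def)
qed

section \<open>Resolvability of directed unions\<close>

unbundle cardinal_syntax

section \<open>Closing a set of indices under a set-valued operation\<close>

lemma countable_iff_card_of_nat: "countable A \<longleftrightarrow> |A| \<le>o |UNIV :: nat set|"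
  unfolding countable_def card_of_ordLeq[symmetric] by auto

text \<open>The operation is binary and set-valued so that one hull can absorb upper bounds of pairs
  together with countably many chosen witnesses.\<close>

definition grow :: "('i \<Rightarrow> 'i \<Rightarrow> 'i set) \<Rightarrow> 'i set \<Rightarrow> 'i set" where
  "grow F S = S \<union> (\<Union>a\<in>S. \<Union>b\<in>S. F a b)"

definition closed_hull :: "('i \<Rightarrow> 'i \<Rightarrow> 'i set) \<Rightarrow> 'i set \<Rightarrow> 'i set" where
  "closed_hull F S = (\<Union>n. (grow F ^^ n) S)"

lemma grow_funpow_mono:
  assumes "m \<le> n"
  shows "(grow F ^^ m) S \<subseteq> (grow F ^^ n) S"
  by (rule lift_Suc_mono_le[OF _ assms]) (auto simp: grow_def)

lemma closed_hull_superset: "S \<subseteq> closed_hull F S"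
  using UN_upper[of 0 UNIV "\<lambda>n. (grow F ^^ n) S"] by (simp add: closed_hull_def)

lemma closed_hull_closed:
  assumes "a \<in> closed_hull F S" "b \<in> closed_hull F S"
  shows "F a b \<subseteq> closed_hull F S"
proof -
  obtain m n where "a \<in> (grow F ^^ m) S" "b \<in> (grow F ^^ n) S"
    using assms by (auto simp: closed_hull_def)
  then have "a \<in> (grow F ^^ max m n) S" "b \<in> (grow F ^^ max m n) S"
    using grow_funpow_mono[of m "max m n" F S] grow_funpow_mono[of n "max m n" F S] by auto
  then have "F a b \<subseteq> (grow F ^^ Suc (max m n)) S" by (auto simp: grow_def)
  then show ?thesis unfolding closed_hull_def by blast
qed

lemma closed_hull_subset:
  assumes "S \<subseteq> B" "\<And>a b. a \<in> B \<Longrightarrow> b \<in> B \<Longrightarrow> F a b \<subseteq> B"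
  shows "closed_hull F S \<subseteq> B"
proof -
  have "(grow F ^^ n) S \<subseteq> B" for n
  proof (induction n)
    case (Suc n)
    then show ?case using assms(2) by (fastforce simp: grow_def)
  qed (use assms in simp)
  then show ?thesis by (auto simp: closed_hull_def)
qed

lemma closed_hull_mono:
  assumes "S \<subseteq> S'"
  shows "closed_hull F S \<subseteq> closed_hull F S'"
  by (rule closed_hull_subset[OF order.trans[OF assms closed_hull_superset] closed_hull_closed])

lemma countable_closed_hull:
  assumes "countable S" "\<And>a b. countable (F a b)"
  shows "countable (closed_hull F S)"
proof -
  have "countable ((grow F ^^ n) S)" for n
    by (induction n) (use assms in \<open>auto simp: grow_def\<close>)
  then show ?thesis by (auto simp: closed_hull_def)
qed

text \<open>An infinite cardinal is unchanged by squaring and by countable unions of sets of its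
  size, so no stage of the hull, and not the union of the stages, exceeds it.\<close>

lemma closed_hull_ordLeq:
  assumes inf: "infinite S" and F: "\<And>a b. countable (F a b)"
  shows "|closed_hull F S| \<le>o |S|"
proof -
  have nat: "|UNIV :: nat set| \<le>o |S|" using inf infinite_iff_card_of_nat by blast
  have F': "|F a b| \<le>o |S|" for a b
    using F nat countable_iff_card_of_nat ordLeq_transitive by blast
  have "|(grow F ^^ n) S| \<le>o |S|" for n
  proof (induction n)
    case 0
    show ?case using card_of_mono1[of S S] by simp
  next
    case (Suc n)
    let ?G = "(grow F ^^ n) S"
    have "|\<Union>a\<in>?G. \<Union>b\<in>?G. F a b| \<le>o |S|"
      by (rule card_of_UNION_ordLeq_infinite[OF inf Suc.IH ballI],
          rule card_of_UNION_ordLeq_infinite[OF inf Suc.IH ballI], rule F')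
    then have "|?G \<union> (\<Union>a\<in>?G. \<Union>b\<in>?G. F a b)| \<le>o |S|"
      using card_of_Un_ordLeq_infinite_Field[of "|S|"] inf Suc.IH
        by (simp add: Field_card_of card_of_Card_order card_of_card_order_on)
    then show ?case by (simp add: grow_def[of F ?G])
  qed
  then show ?thesis
    unfolding closed_hull_def by (intro card_of_UNION_ordLeq_infinite[OF inf nat] ballI)
qed

text \<open>\<open>lev V\<close> is the first stage at which \<open>V\<close> appears, \<open>R\<close> the strict order of the stages, and
  \<open>dom V U\<close> says that the sets from stages before \<open>lev V\<close> contained in \<open>U\<close> all meet \<open>V\<close>.\<close>

inductive_set glued_labels ::
  "'j rel \<Rightarrow> ('a set \<Rightarrow> 'j) \<Rightarrow> ('j \<Rightarrow> ('a set \<times> ('a \<Rightarrow> real) set) set) \<Rightarrow> ('a set \<Rightarrow> 'a set \<Rightarrow> bool) \<Rightarrow>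
    'a set set \<Rightarrow> ('a set \<times> ('a \<Rightarrow> real) set) set"
  for R lev E dom \<D>
  where
    start: "V \<in> \<D> \<Longrightarrow> (V, s) \<in> E (lev V) \<Longrightarrow> \<forall>i. (i, lev V) \<notin> R \<Longrightarrow>
      (V, s) \<in> glued_labels R lev E dom \<D>"
  | step: "V \<in> \<D> \<Longrightarrow> (V, s) \<in> E (lev V) \<Longrightarrow> (U, t) \<in> glued_labels R lev E dom \<D> \<Longrightarrow>
      (lev U, lev V) \<in> R \<Longrightarrow> dom V U \<Longrightarrow> (V, s \<union> t) \<in> glued_labels R lev E dom \<D>"

text \<open>For the pullbacks of the open sets under a map onto \<open>Y\<close> this says that the map is skeletal.\<close>

definition regular_in :: "'a topology \<Rightarrow> 'a set set \<Rightarrow> bool" where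
  "regular_in X \<B> \<longleftrightarrow> (\<forall>V. openin X V \<and> V \<noteq> {} \<longrightarrow>
     (\<exists>U\<in>\<B>. U \<noteq> {} \<and> (\<forall>U'\<in>\<B>. U' \<noteq> {} \<and> U' \<subseteq> U \<longrightarrow> U' \<inter> V \<noteq> {})))"

text \<open>A label of \<open>V\<close> at stage \<open>j\<close> combines a label from the
  resolution of that stage with a label of an earlier \<open>U\<close> such that every nonempty
  earlier set inside \<open>U\<close> meets \<open>V\<close>. The first part opposes sets of the
  same stage, the second opposes earlier ones by induction. Regularity of the union of the earlier
  stages supplies enough such \<open>U\<close> for density.\<close>

lemma resolvable_Union_chain:
  fixes \<B> :: "'j \<Rightarrow> 'a set set"
  assumes wo: "well_order_on J r"
    and mono: "\<And>i j. (i, j) \<in> r \<Longrightarrow> \<B> i \<subseteq> \<B> j"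
    and op: "\<And>j U. j \<in> J \<Longrightarrow> U \<in> \<B> j \<Longrightarrow> openin X U"
    and Int: "\<And>j U V. j \<in> J \<Longrightarrow> U \<in> \<B> j \<Longrightarrow> V \<in> \<B> j \<Longrightarrow> U \<inter> V \<in> \<B> j"
    and res: "\<And>j. j \<in> J \<Longrightarrow> resolvable X (\<B> j)"
    and reg: "\<And>j. j \<in> J \<Longrightarrow> \<exists>i. (i, j) \<in> r - Id \<Longrightarrow> regular_in X (\<Union>i\<in>{i. (i, j) \<in> r - Id}. \<B> i)"
  shows "resolvable X (\<Union>j\<in>J. \<B> j)"
proof -
  let ?R = "r - Id" and ?D = "\<Union>j\<in>J. \<B> j"
  let ?below = "\<lambda>j. \<Union>i\<in>{i. (i, j) \<in> r - Id}. \<B> i"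
  have wf: "wf ?R" using wo by (simp add: well_order_on_def)
  have lin: "linear_order_on J r" using wo by (simp add: well_order_on_def)
  have rJ: "i \<in> J \<and> j \<in> J" if "(i, j) \<in> r" for i j
    using lin that unfolding linear_order_on_def partial_order_on_def preorder_on_def by blast
  have tr: "(i, k) \<in> r" if "(i, j) \<in> r" "(j, k) \<in> r" for i j k
  proof -
    have "trans r"
      using lin unfolding linear_order_on_def partial_order_on_def preorder_on_def by simp
    then show ?thesis using that by (rule transD)
  qed
  have asym: "i = j" if "(i, j) \<in> r" "(j, i) \<in> r" for i j
  proof -
    have "antisym r" using lin unfolding linear_order_on_def partial_order_on_def by simp
    then show ?thesis using that by (rule antisymD)
  qed
  have tot: "(i, j) \<in> r \<or> (j, i) \<in> ?R" if "i \<in> J" "j \<in> J" for i j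
  proof -
    have "refl_on J r" "total_on J r"
      using lin unfolding linear_order_on_def partial_order_on_def preorder_on_def by simp_all
    then show ?thesis
      using that by (cases "i = j") (auto simp: total_on_def dest: refl_onD)
  qed
  have "\<exists>j. j \<in> J \<and> U \<in> \<B> j \<and> (\<forall>i\<in>J. U \<in> \<B> i \<longrightarrow> (j, i) \<in> r)" if U: "U \<in> ?D" for U
  proof -
    obtain i where "i \<in> {j \<in> J. U \<in> \<B> j}" using U by blast
    from wfE_min[OF wf this] obtain j where j: "j \<in> {j \<in> J. U \<in> \<B> j}"
      "\<And>i. (i, j) \<in> ?R \<Longrightarrow> i \<notin> {j \<in> J. U \<in> \<B> j}" by blast
    then have "(j, i) \<in> r" if "i \<in> J" "U \<in> \<B> i" for i using tot[of j i] that by blast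
    then show ?thesis using j by blast
  qed
  then obtain lev where lev: "\<And>U. U \<in> ?D \<Longrightarrow> lev U \<in> J" "\<And>U. U \<in> ?D \<Longrightarrow> U \<in> \<B> (lev U)"
    "\<And>U i. U \<in> ?D \<Longrightarrow> i \<in> J \<Longrightarrow> U \<in> \<B> i \<Longrightarrow> (lev U, i) \<in> r"
    by metis
  have "\<forall>j. \<exists>E. j \<in> J \<longrightarrow> resolution X (\<B> j) E" using res unfolding resolvable_def by blast
  then obtain E where E0: "\<And>j. j \<in> J \<Longrightarrow> resolution X (\<B> j) (E j)" by metis
  have E:
    "\<And>j. j \<in> J \<Longrightarrow> \<forall>U s. (U, s) \<in> E j \<longrightarrow> label X s"
    "\<And>j. j \<in> J \<Longrightarrow> \<forall>U s V t. (U, s) \<in> E j \<and> (V, t) \<in> E j \<and> U \<inter> V = {} \<longrightarrow> opposed s t"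
    "\<And>j. j \<in> J \<Longrightarrow> \<forall>U\<in>\<B> j. \<forall>W. openin X W \<and> W \<noteq> {} \<and> W \<subseteq> U \<longrightarrow>
        (\<exists>s. (U, s) \<in> E j \<and> W \<inter> pos_set X s \<noteq> {})"
    using E0 unfolding resolution_def by simp_all
  define dom where "dom V U \<longleftrightarrow> (\<forall>U'\<in>?below (lev V). U' \<noteq> {} \<and> U' \<subseteq> U \<longrightarrow> U' \<inter> V \<noteq> {})" for V U
  define G where "G = glued_labels ?R lev E dom ?D"
  have GD: "V \<in> ?D" if "(V, s) \<in> G" for V s
    using that unfolding G_def by (cases rule: glued_labels.cases) blast+
  have lab: "label X s" if "(V, s) \<in> G" for V s
    using that unfolding G_def
  proof (induction rule: glued_labels.induct)
    case (start V s)
    then show ?case using E(1)[OF lev(1)] by blast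
  next
    case (step V s U t)
    then show ?case using E(1)[OF lev(1)] label_Un by blast
  qed
  have GE: "\<exists>s'\<subseteq>s. (V, s') \<in> E (lev V)" if "(V, s) \<in> G" for V s
    using that unfolding G_def by (cases rule: glued_labels.cases) blast+
  have below: "U \<in> ?below j" if "U \<in> ?D" "(lev U, j) \<in> ?R" for U j
    using that lev(2) by blast
  have below_Int: "U \<inter> V \<in> ?below j" if UV: "U \<in> ?below j" "V \<in> ?below j" for U V j
  proof -
    obtain i k where i: "(i, j) \<in> ?R" "U \<in> \<B> i" and k: "(k, j) \<in> ?R" "V \<in> \<B> k" using UV by blast
    have "(i, k) \<in> r \<or> (k, i) \<in> r" using tot[of i k] rJ i k by blast
    then show ?thesis
    proof
      assume "(i, k) \<in> r"
      then have "U \<in> \<B> k" using mono i by blast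
      then have "U \<inter> V \<in> \<B> k" using Int[of k] rJ k by blast
      then show ?thesis using k by blast
    next
      assume "(k, i) \<in> r"
      then have "V \<in> \<B> i" using mono k by blast
      then have "U \<inter> V \<in> \<B> i" using Int[of i] rJ i by blast
      then show ?thesis using i by blast
    qed
  qed
  have opp: "opposed s s'" if "(V, s) \<in> G" "(V', s') \<in> G" "V \<inter> V' = {}" "lev V = j" "(lev V', j) \<in> r"
    for j V V' s s'
    using wf that
  proof (induction j arbitrary: V V' s s' rule: wf_induct_rule)
    case (less j)
    show ?case
    proof (cases "lev V' = j")
      case True
      obtain s1 s2 where s: "s1 \<subseteq> s" "(V, s1) \<in> E j" "s2 \<subseteq> s'" "(V', s2) \<in> E j"
        using GE[OF less.prems(1)] GE[OF less.prems(2)] True less.prems(4) by metis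
      have "j \<in> J" using lev(1) GD less.prems by blast
      then have "opposed s1 s2" using E(2) s less.prems(3) by blast
      then show ?thesis using opposed_mono s by blast
    next
      case False
      then have V'j: "(lev V', j) \<in> ?R" using less.prems by blast
      obtain s1 U t where U: "s = s1 \<union> t" "(U, t) \<in> G" "(lev U, j) \<in> ?R" "dom V U"
        using less.prems(1) unfolding G_def
      proof (cases rule: glued_labels.cases)
        case start
        then show ?thesis using V'j less.prems(4) by blast
      next
        case (step s1 U t)
        show ?thesis
          by (rule that[of s1 t U]) (use step less.prems(4) in \<open>simp_all add: G_def\<close>)
      qed
      \<comment> \<open>The earlier stages form a chain and each is closed under intersection, so
        \<open>U \<inter> V'\<close> belongs to one of them. If it were nonempty,
        \<open>dom V U\<close> would make it meet \<open>V\<close>.\<close>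
      have "U \<inter> V' = {}"
      proof (rule ccontr)
        assume ne: "U \<inter> V' \<noteq> {}"
        have UV': "U \<inter> V' \<in> ?below j"
          using below_Int below[OF GD[OF U(2)] U(3)] below[OF GD[OF less.prems(2)] V'j] by blast
        have "\<forall>U'\<in>?below j. U' \<noteq> {} \<and> U' \<subseteq> U \<longrightarrow> U' \<inter> V \<noteq> {}"
          using U(4) less.prems(4) unfolding dom_def by simp
        from this[rule_format, OF UV'] have "(U \<inter> V') \<inter> V \<noteq> {}" using ne by simp
        then show False using less.prems(3) by blast
      qed
      \<comment> \<open>Both \<open>U\<close> and \<open>V'\<close> lie below \<open>j\<close>. The
        induction hypothesis is applied at the later of the two, with the roles exchanged if that is
        \<open>V'\<close>.\<close>
      have "opposed t s'"
      proof (cases "(lev V', lev U) \<in> r")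
        case True
        show ?thesis
          by (rule less.IH[OF U(3) U(2) less.prems(2) \<open>U \<inter> V' = {}\<close> refl True])
      next
        case False
        then have UV: "(lev U, lev V') \<in> r"
          using tot[of "lev V'" "lev U"] lev(1) GD U(2) less.prems(2) by blast
        have "V' \<inter> U = {}" using \<open>U \<inter> V' = {}\<close> by blast
        from less.IH[OF V'j less.prems(2) U(2) this refl UV]
        show ?thesis by (rule opposed_sym)
      qed
      then show ?thesis by (rule opposed_mono) (use U(1) in auto)
    qed
  qed
  have den: "\<exists>s. (V, s) \<in> G \<and> W \<inter> pos_set X s \<noteq> {}"
    if "V \<in> ?D" "openin X W" "W \<noteq> {}" "W \<subseteq> V" "lev V = j" for j V W
    using wf that
  proof (induction j arbitrary: V W rule: wf_induct_rule)
    case (less j)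
    have "j \<in> J" "V \<in> \<B> j" using lev(1,2) less.prems by blast+
    then obtain s where s: "(V, s) \<in> E j" "W \<inter> pos_set X s \<noteq> {}"
      using E(3) less.prems(2-4) by blast
    show ?case
    proof (cases "\<exists>i. (i, j) \<in> ?R")
      case False
      then have "(V, s) \<in> G"
        unfolding G_def using s(1) less.prems(1,5) by (intro glued_labels.start) blast+
      then show ?thesis using s(2) by blast
    next
      case True
      have "label X s" using E(1)[OF \<open>j \<in> J\<close>] s(1) by blast
      then have W': "openin X (W \<inter> pos_set X s)" using less.prems(2) openin_pos_set by blast
      \<comment> \<open>Regularity is applied to \<open>W \<inter> pos_set X s\<close> rather than
        to \<open>W\<close>: the resulting \<open>U\<close> satisfies \<open>dom V U\<close>, and a
        label \<open>t\<close> of \<open>U\<close> can then be found that is positive at a point of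
        \<open>W\<close> where \<open>s\<close> is positive as well.\<close>
      from reg[OF \<open>j \<in> J\<close> True] obtain U where U: "U \<in> ?below j" "U \<noteq> {}"
        "\<And>U'. U' \<in> ?below j \<Longrightarrow> U' \<noteq> {} \<Longrightarrow> U' \<subseteq> U \<Longrightarrow> U' \<inter> (W \<inter> pos_set X s) \<noteq> {}"
        unfolding regular_in_def using W' s(2) by meson
      obtain i where i: "(i, j) \<in> ?R" "U \<in> \<B> i" using U(1) by blast
      have iJ: "i \<in> J" using i rJ by blast
      have UD: "U \<in> ?D" using i iJ by blast
      have "(lev U, i) \<in> r" by (rule lev(3)[OF UD iJ i(2)])
      then have lU: "(lev U, j) \<in> ?R" using i(1) tr[of "lev U" i j] asym[of i j] by blast
      have "dom V U"
        unfolding dom_def using U(3) less.prems(4,5) by blast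
      have "openin X U" using op iJ i(2) by blast
      then have "openin X (U \<inter> (W \<inter> pos_set X s))" using W' by blast
      moreover have "U \<inter> (W \<inter> pos_set X s) \<noteq> {}" using U by blast
      ultimately obtain t where t: "(U, t) \<in> G" "(U \<inter> (W \<inter> pos_set X s)) \<inter> pos_set X t \<noteq> {}"
        using less.IH[OF lU UD _ _ _ refl, of "U \<inter> (W \<inter> pos_set X s)"] by blast
      have "(V, s \<union> t) \<in> G"
        using t(1) unfolding G_def
        by (rule glued_labels.step[rotated 2]) (use lU less.prems s(1) \<open>dom V U\<close> in auto)
      moreover have "W \<inter> pos_set X (s \<union> t) \<noteq> {}" using t(2) unfolding pos_set_Un by blast
      ultimately show ?thesis by blast
    qed
  qed
  show ?thesis
  proof (rule resolvableI[of G])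
    show "opposed s t" if G: "(U, s) \<in> G" "(V, t) \<in> G" "U \<inter> V = {}" for U s V t
    proof (cases "(lev V, lev U) \<in> r")
      case True
      then show ?thesis using opp[OF G refl] by blast
    next
      case False
      then have "(lev U, lev V) \<in> r" using tot[of "lev V" "lev U"] lev(1) GD G by blast
      moreover have "V \<inter> U = {}" using G by blast
      ultimately show ?thesis using opp[OF G(2,1) _ refl] opposed_sym by blast
    qed
  qed (use lab den in blast)+
qed

section \<open>Regularity and resolvability over directed sets of indices\<close>

definition directed_subset :: "'i rel \<Rightarrow> 'i set \<Rightarrow> bool" where
  "directed_subset r B \<longleftrightarrow> B \<noteq> {} \<and> (\<forall>a\<in>B. \<forall>b\<in>B. \<exists>c\<in>B. (a, c) \<in> r \<and> (b, c) \<in> r)"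

lemma regular_inE:
  assumes "regular_in X \<B>" "openin X V" "V \<noteq> {}"
  obtains U where "U \<in> \<B>" "U \<noteq> {}"
    "\<And>U'. U' \<in> \<B> \<Longrightarrow> U' \<noteq> {} \<Longrightarrow> U' \<subseteq> U \<Longrightarrow> U' \<inter> V \<noteq> {}"
proof -
  have "\<exists>U\<in>\<B>. U \<noteq> {} \<and> (\<forall>U'\<in>\<B>. U' \<noteq> {} \<and> U' \<subseteq> U \<longrightarrow> U' \<inter> V \<noteq> {})"
    using assms unfolding regular_in_def by simp
  then show thesis using that by (elim bexE conjE) simp
qed

lemma not_regular_inE:
  assumes "\<not> regular_in X \<B>"
  obtains V where "openin X V" "V \<noteq> {}"
    "\<And>U. U \<in> \<B> \<Longrightarrow> U \<noteq> {} \<Longrightarrow> \<exists>U'\<in>\<B>. U' \<noteq> {} \<and> U' \<subseteq> U \<and> U' \<inter> V = {}"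
proof -
  obtain V where "openin X V" "V \<noteq> {}"
    "\<forall>U\<in>\<B>. U \<noteq> {} \<longrightarrow> \<not> (\<forall>U'\<in>\<B>. U' \<noteq> {} \<and> U' \<subseteq> U \<longrightarrow> U' \<inter> V \<noteq> {})"
    using assms unfolding regular_in_def by auto
  then show thesis by (intro that[of V]) auto
qed

lemma directed_subset_Union_chain:
  assumes "I \<noteq> {}" "\<And>i. i \<in> I \<Longrightarrow> directed_subset r (D i)"
    and "\<And>i j. i \<in> I \<Longrightarrow> j \<in> I \<Longrightarrow> D i \<subseteq> D j \<or> D j \<subseteq> D i"
  shows "directed_subset r (\<Union>i\<in>I. D i)"
  unfolding directed_subset_def
proof (intro conjI ballI)
  show "(\<Union>i\<in>I. D i) \<noteq> {}" using assms(1,2) unfolding directed_subset_def by blast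
  fix a b assume "a \<in> (\<Union>i\<in>I. D i)" "b \<in> (\<Union>i\<in>I. D i)"
  then obtain i j where ij: "i \<in> I" "a \<in> D i" "j \<in> I" "b \<in> D j" by blast
  obtain k where "k \<in> I" "a \<in> D k" "b \<in> D k" using ij assms(3)[of i j] by blast
  then obtain c where "c \<in> D k" "(a, c) \<in> r" "(b, c) \<in> r"
    using assms(2)[of k] unfolding directed_subset_def by blast
  then show "\<exists>c\<in>(\<Union>i\<in>I. D i). (a, c) \<in> r \<and> (b, c) \<in> r" using \<open>k \<in> I\<close> by blast
qed

text \<open>An abstraction of an inverse system: \<open>T a\<close> stands for the preimages in
  \<open>X\<close> of the open sets of the space at \<open>a\<close>. The last assumption combines
  sigma-completeness with the embedding of the space at a supremum into the limit of the spaces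
  below it.\<close>

locale sigma_directed_family =
  fixes X :: "'a topology" and A :: "'i set" and r :: "'i rel" and T :: "'i \<Rightarrow> 'a set set"
  assumes mono: "(a, b) \<in> r \<Longrightarrow> T a \<subseteq> T b"
    and op: "a \<in> A \<Longrightarrow> U \<in> T a \<Longrightarrow> openin X U"
    and Int: "a \<in> A \<Longrightarrow> U \<in> T a \<Longrightarrow> V \<in> T a \<Longrightarrow> U \<inter> V \<in> T a"
    and resolvable: "a \<in> A \<Longrightarrow> resolvable X (T a)"
    and regular: "a \<in> A \<Longrightarrow> regular_in X (T a)"
    and countable_base: "a \<in> A \<Longrightarrow>
      \<exists>\<C>. countable \<C> \<and> \<C> \<subseteq> T a \<and> (\<forall>U\<in>T a. U \<noteq> {} \<longrightarrow> (\<exists>U'\<in>\<C>. U' \<noteq> {} \<and> U' \<subseteq> U))"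
    and countable_sup: "countable B \<Longrightarrow> B \<subseteq> A \<Longrightarrow> directed_subset r B \<Longrightarrow>
      \<exists>b\<in>A. (\<forall>a\<in>B. (a, b) \<in> r) \<and>
        (\<forall>U\<in>T b. U \<noteq> {} \<longrightarrow> (\<exists>U'\<in>\<Union>(T ` B). U' \<noteq> {} \<and> U' \<subseteq> U))"
begin

text \<open>The set that regularity of \<open>T b\<close> provides at an upper bound
  \<open>b\<close> can be shrunk to a member of the smaller family, and every set against which that
  member is tested already lies in \<open>T b\<close>.\<close>

lemma regular_countable:
  assumes "countable B" "B \<subseteq> A" "directed_subset r B"
  shows "regular_in X (\<Union>(T ` B))"
  unfolding regular_in_def
proof (intro allI impI, elim conjE)
  fix V assume V: "openin X V" "V \<noteq> {}"
  obtain b where b: "b \<in> A" "\<forall>a\<in>B. (a, b) \<in> r"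
    "\<forall>U\<in>T b. U \<noteq> {} \<longrightarrow> (\<exists>U'\<in>\<Union>(T ` B). U' \<noteq> {} \<and> U' \<subseteq> U)"
    using countable_sup[OF assms] by (elim bexE conjE)
  obtain U where U: "U \<in> T b" "U \<noteq> {}" "\<forall>U'\<in>T b. U' \<noteq> {} \<and> U' \<subseteq> U \<longrightarrow> U' \<inter> V \<noteq> {}"
    using regular[OF b(1)] V unfolding regular_in_def by meson
  obtain U' where U': "U' \<in> \<Union>(T ` B)" "U' \<noteq> {}" "U' \<subseteq> U"
    using b(3)[rule_format, OF U(1,2)] by (elim bexE conjE)
  have "W \<inter> V \<noteq> {}" if "W \<in> \<Union>(T ` B)" "W \<noteq> {} \<and> W \<subseteq> U'" for W
  proof -
    have "W \<in> T b" using that(1) b(2) mono by blast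
    then show ?thesis using U(3) that(2) U'(3) by blast
  qed
  then show "\<exists>U\<in>\<Union>(T ` B). U \<noteq> {} \<and> (\<forall>W\<in>\<Union>(T ` B). W \<noteq> {} \<and> W \<subseteq> U \<longrightarrow> W \<inter> V \<noteq> {})"
    using U' by blast
qed

text \<open>A failure of regularity reflects to a countable directed subset closed under the choice of
  witnesses.\<close>

lemma regular_directed:
  assumes B: "B \<subseteq> A" "directed_subset r B"
  shows "regular_in X (\<Union>(T ` B))"
proof (rule ccontr)
  assume "\<not> ?thesis"
  then obtain V where V: "openin X V" "V \<noteq> {}"
    "\<And>U. U \<in> \<Union>(T ` B) \<Longrightarrow> U \<noteq> {} \<Longrightarrow> \<exists>U'\<in>\<Union>(T ` B). U' \<noteq> {} \<and> U' \<subseteq> U \<and> U' \<inter> V = {}"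
    by (rule not_regular_inE) (rule that)
  \<comment> \<open>\<open>g U\<close> becomes an index in \<open>B\<close> at which some nonempty
    subset of \<open>U\<close> misses \<open>V\<close>.\<close>
  have "\<forall>U. \<exists>b. U \<in> \<Union>(T ` B) \<and> U \<noteq> {} \<longrightarrow>
      b \<in> B \<and> (\<exists>U'\<in>T b. U' \<noteq> {} \<and> U' \<subseteq> U \<and> U' \<inter> V = {})"
  proof
    fix U
    show "\<exists>b. U \<in> \<Union>(T ` B) \<and> U \<noteq> {} \<longrightarrow>
      b \<in> B \<and> (\<exists>U'\<in>T b. U' \<noteq> {} \<and> U' \<subseteq> U \<and> U' \<inter> V = {})"
    proof (cases "U \<in> \<Union>(T ` B) \<and> U \<noteq> {}")
      case True
      then obtain U' where U': "U' \<in> \<Union>(T ` B)" "U' \<noteq> {}" "U' \<subseteq> U" "U' \<inter> V = {}"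
        using V(3)[of U] by blast
      obtain b where "b \<in> B" "U' \<in> T b" using U'(1) by blast
      then show ?thesis using U' by blast
    qed blast
  qed
  then obtain g where g: "\<And>U. U \<in> \<Union>(T ` B) \<Longrightarrow> U \<noteq> {} \<Longrightarrow>
      g U \<in> B \<and> (\<exists>U'\<in>T (g U). U' \<noteq> {} \<and> U' \<subseteq> U \<and> U' \<inter> V = {})"
    by metis
  have "\<forall>a. \<exists>\<C>. a \<in> A \<longrightarrow> countable \<C> \<and> \<C> \<subseteq> T a \<and> (\<forall>U\<in>T a. U \<noteq> {} \<longrightarrow> (\<exists>U'\<in>\<C>. U' \<noteq> {} \<and> U' \<subseteq> U))"
    using countable_base by simp
  then obtain \<C> where \<C>: "\<And>a. a \<in> A \<Longrightarrow> countable (\<C> a) \<and> \<C> a \<subseteq> T a \<and>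
      (\<forall>U\<in>T a. U \<noteq> {} \<longrightarrow> (\<exists>U'\<in>\<C> a. U' \<noteq> {} \<and> U' \<subseteq> U))"
    by metis
  have "\<forall>a b. \<exists>c. a \<in> B \<and> b \<in> B \<longrightarrow> c \<in> B \<and> (a, c) \<in> r \<and> (b, c) \<in> r"
    using B(2) unfolding directed_subset_def by blast
  then obtain u where u: "\<And>a b. a \<in> B \<Longrightarrow> b \<in> B \<Longrightarrow> u a b \<in> B \<and> (a, u a b) \<in> r \<and> (b, u a b) \<in> r"
    by metis
  \<comment> \<open>The hull under \<open>F\<close> contains upper bounds of pairs and the
    witnessing indices for a countable base of each \<open>T a\<close>. The empty set is removed
    because \<open>g\<close> is controlled only on nonempty sets.\<close>
  define F where "F a b = (if a \<in> B \<and> b \<in> B then insert (u a b) (g ` (\<C> a - {{}})) else {})" for a b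
  have Fc: "countable (F a b)" for a b
    using \<C> B(1) by (auto simp: F_def)
  have FB: "F a b \<subseteq> B" if ab: "a \<in> B" "b \<in> B" for a b
  proof -
    have "\<C> a \<subseteq> \<Union>(T ` B)" using \<C>[of a] B(1) ab by blast
    then have "g ` (\<C> a - {{}}) \<subseteq> B" using g by blast
    then show ?thesis using u[OF ab] by (simp add: F_def)
  qed
  obtain b0 where "b0 \<in> B" using B(2) unfolding directed_subset_def by blast
  define B0 where "B0 = closed_hull F {b0}"
  have B0: "B0 \<subseteq> B" unfolding B0_def by (rule closed_hull_subset[OF _ FB]) (simp add: \<open>b0 \<in> B\<close>)
  have ne: "b0 \<in> B0" using closed_hull_superset[of "{b0}" F] by (simp add: B0_def)
  have cl: "F a b \<subseteq> B0" if "a \<in> B0" "b \<in> B0" for a b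
    using closed_hull_closed that unfolding B0_def by metis
  have "directed_subset r B0"
    unfolding directed_subset_def
  proof (intro conjI ballI)
    show "B0 \<noteq> {}" using ne by blast
    fix a b assume ab: "a \<in> B0" "b \<in> B0"
    then have "a \<in> B" "b \<in> B" using B0 by blast+
    then show "\<exists>c\<in>B0. (a, c) \<in> r \<and> (b, c) \<in> r"
      using cl[OF ab] u[of a b] by (auto simp: F_def)
  qed
  moreover have "countable B0" unfolding B0_def by (rule countable_closed_hull[OF _ Fc]) simp
  ultimately have "regular_in X (\<Union>(T ` B0))" using regular_countable B0 B(1) by simp
  from this V(1,2) obtain U where U: "U \<in> \<Union>(T ` B0)" "U \<noteq> {}"
    "\<And>U'. U' \<in> \<Union>(T ` B0) \<Longrightarrow> U' \<noteq> {} \<Longrightarrow> U' \<subseteq> U \<Longrightarrow> U' \<inter> V \<noteq> {}"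
    by (rule regular_inE) (rule that)
  obtain a where a: "a \<in> B0" "U \<in> T a" using U(1) by blast
  then have "a \<in> B" "a \<in> A" using B0 B(1) by blast+
  \<comment> \<open>A base set inside \<open>U\<close> has its witness \<open>W\<close> at the index
    \<open>g U'\<close>, which the hull contains; so \<open>W\<close> defeats the choice of
    \<open>U\<close>.\<close>
  obtain U' where U': "U' \<in> \<C> a" "U' \<noteq> {}" "U' \<subseteq> U" using \<C>[OF \<open>a \<in> A\<close>] a(2) U(2) by blast
  have "g U' \<in> F a a" using U' \<open>a \<in> B\<close> by (simp add: F_def)
  then have "g U' \<in> B0" using cl[OF a(1) a(1)] by blast
  have "U' \<in> \<Union>(T ` B)" using \<C>[OF \<open>a \<in> A\<close>] U'(1) \<open>a \<in> B\<close> by blast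
  from g[OF this U'(2)] obtain W where W: "W \<in> T (g U')" "W \<noteq> {}" "W \<subseteq> U'" "W \<inter> V = {}" by blast
  have "W \<in> \<Union>(T ` B0)" using W(1) \<open>g U' \<in> B0\<close> by blast
  from U(3)[OF this W(2)] show False using W(3,4) U'(3) by blast
qed

text \<open>Induction on the cardinality of \<open>B\<close>. A countable \<open>B\<close> has an
  upper bound \<open>b\<close>, and \<open>T b\<close> contains the whole family. An uncountable
  \<open>B\<close> is exhausted by hulls of initial segments of its cardinal well-order; these are
  directed of smaller cardinality and increase along the order.\<close>

lemma resolvable_directed:
  assumes "B \<subseteq> A" "directed_subset r B"
  shows "resolvable X (\<Union>(T ` B))"
  using assms
proof (induction "|B|" arbitrary: B rule: wf_induct_rule[OF wf_ordLess])
  case (1 B)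
  show ?case
  proof (cases "countable B")
    case True
    obtain b where b: "b \<in> A" "\<forall>a\<in>B. (a, b) \<in> r"
      using countable_sup[OF True 1(2,3)] by (elim bexE conjE)
    then have "\<Union>(T ` B) \<subseteq> T b" using mono by blast
    then show ?thesis by (rule resolvable_subset[OF resolvable[OF b(1)]])
  next
    case False
    then have nat: "|UNIV :: nat set| <o |B|"
      unfolding countable_iff_card_of_nat
      by (subst (asm) not_ordLeq_iff_ordLess) (auto simp: card_of_Well_order)
    have "\<forall>a b. \<exists>c. a \<in> B \<and> b \<in> B \<longrightarrow> c \<in> B \<and> (a, c) \<in> r \<and> (b, c) \<in> r"
      using 1(3) unfolding directed_subset_def by blast
    then obtain u where u: "\<And>a b. a \<in> B \<Longrightarrow> b \<in> B \<Longrightarrow> u a b \<in> B \<and> (a, u a b) \<in> r \<and> (b, u a b) \<in> r"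
      by metis
    define F where "F a b = {u a b}" for a b
    let ?w = "|B|"
    \<comment> \<open>The segment \<open>under ?w b\<close> includes \<open>b\<close>, so the hulls
      cover \<open>B\<close>; closing it under \<open>u\<close> makes it directed.\<close>
    define D where "D b = closed_hull F (under ?w b)" for b
    have wo: "well_order_on B ?w" by (rule card_of_well_order_on)
    then have "linear_order_on B ?w" by (simp add: well_order_on_def)
    then have w: "refl_on B ?w" "trans ?w" "total_on B ?w" "?w \<subseteq> B \<times> B"
      unfolding linear_order_on_def partial_order_on_def preorder_on_def by simp_all
    have under_B: "under ?w b \<subseteq> B" for b using w(4) unfolding under_def by blast
    have DB: "D b \<subseteq> B" for b
      unfolding D_def by (rule closed_hull_subset[OF under_B]) (use u in \<open>auto simp: F_def\<close>)
    have Dmono: "D a \<subseteq> D b" if "(a, b) \<in> ?w" for a b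
    proof -
      have "under ?w a \<subseteq> under ?w b" using w(2) that unfolding under_def by (auto dest: transD)
      then show ?thesis unfolding D_def by (rule closed_hull_mono)
    qed
    have bD: "b \<in> D b" if "b \<in> B" for b
    proof -
      have "b \<in> under ?w b" using w(1) that unfolding under_def by (auto dest: refl_onD)
      then show ?thesis unfolding D_def using closed_hull_superset[of "under ?w b" F] by (rule subsetD[rotated])
    qed
    have Ddir: "directed_subset r (D b)" if "b \<in> B" for b
      unfolding directed_subset_def
    proof (intro conjI ballI)
      show "D b \<noteq> {}" using bD[OF that] by blast
      fix a c assume ac: "a \<in> D b" "c \<in> D b"
      then have "F a c \<subseteq> D b" unfolding D_def by (rule closed_hull_closed)
      then have "u a c \<in> D b" by (simp add: F_def)
      then show "\<exists>e\<in>D b. (a, e) \<in> r \<and> (c, e) \<in> r" using u[of a c] ac DB by blast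
    qed
    \<comment> \<open>A finite segment may have an infinite hull, but a countable one, which is
      still smaller than the uncountable \<open>B\<close>. Otherwise the hull is no larger than the
      segment, a proper initial part of a cardinal well-order.\<close>
    have Dcard: "|D b| <o |B|" if "b \<in> B" for b
    proof (cases "finite (underS ?w b)")
      case True
      have "under ?w b \<subseteq> insert b (underS ?w b)" unfolding under_def underS_def by blast
      then have "finite (under ?w b)" using True by (meson finite_insert finite_subset)
      then have "countable (D b)"
        unfolding D_def by (intro countable_closed_hull) (auto simp: F_def countable_finite)
      then have "|D b| \<le>o |UNIV :: nat set|" by (simp add: countable_iff_card_of_nat)
      then show ?thesis using nat by (rule ordLeq_ordLess_trans)
    next
      case False
      have sub: "underS ?w b \<subseteq> under ?w b" "under ?w b \<subseteq> insert b (underS ?w b)"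
        unfolding under_def underS_def by blast+
      have "|D b| \<le>o |under ?w b|"
        unfolding D_def using False sub(1) finite_subset
        by (intro closed_hull_ordLeq) (auto simp: F_def)
      also have "|under ?w b| \<le>o |insert b (underS ?w b)|" using sub(2) by (rule card_of_mono1)
      also have "|insert b (underS ?w b)| \<le>o |underS ?w b|"
      proof -
        have "|{b}| \<le>o |underS ?w b|" using False by (intro card_of_singl_ordLeq) auto
        moreover have "|underS ?w b| \<le>o |underS ?w b|" by (rule card_of_mono1) simp
        ultimately show ?thesis
          using card_of_Un_ordLeq_infinite_Field[of "|underS ?w b|" "{b}" "underS ?w b"] False
          by (simp add: Field_card_of card_of_card_order_on)
      qed
      also have "|underS ?w b| <o |B|"
        using that by (intro card_of_underS) (auto simp: Field_card_of card_of_card_order_on)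
      finally show ?thesis .
    qed
    have "resolvable X (\<Union>b\<in>B. \<Union>(T ` D b))"
    proof (rule resolvable_Union_chain[OF wo])
      show "\<Union>(T ` D a) \<subseteq> \<Union>(T ` D b)" if "(a, b) \<in> ?w" for a b
        using Dmono[OF that] by blast
      show "openin X U" if "b \<in> B" "U \<in> \<Union>(T ` D b)" for b U
        using that op DB[of b] 1(2) by blast
      show "U \<inter> V \<in> \<Union>(T ` D b)" if UV: "b \<in> B" "U \<in> \<Union>(T ` D b)" "V \<in> \<Union>(T ` D b)" for b U V
      proof -
        obtain a c where ac: "a \<in> D b" "U \<in> T a" "c \<in> D b" "V \<in> T c" using UV by blast
        obtain e where e: "e \<in> D b" "(a, e) \<in> r" "(c, e) \<in> r"
          using Ddir[OF UV(1)] ac unfolding directed_subset_def by blast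
        then have "U \<in> T e" "V \<in> T e" using mono ac by blast+
        moreover have "e \<in> A" using e(1) DB[of b] 1(2) by blast
        ultimately show ?thesis using Int e(1) by blast
      qed
      show "resolvable X (\<Union>(T ` D b))" if "b \<in> B" for b
        by (rule 1(1)[OF Dcard[OF that] _ Ddir[OF that]]) (use DB[of b] 1(2) in blast)
      \<comment> \<open>The union of the earlier hulls is a chain of directed sets and hence
        directed, so \<open>regular_directed\<close> applies to it whatever its cardinality.\<close>
      show "regular_in X (\<Union>a\<in>{a. (a, b) \<in> ?w - Id}. \<Union>(T ` D a))"
        if b: "b \<in> B" "\<exists>a. (a, b) \<in> ?w - Id" for b
      proof -
        let ?I = "{a. (a, b) \<in> ?w - Id}"
        have I: "a \<in> B" if "a \<in> ?I" for a using that w(4) by blast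
        have "directed_subset r (\<Union>a\<in>?I. D a)"
        proof (rule directed_subset_Union_chain)
          show "?I \<noteq> {}" using b(2) by blast
          show "directed_subset r (D a)" if "a \<in> ?I" for a using Ddir I[OF that] by blast
          show "D a \<subseteq> D c \<or> D c \<subseteq> D a" if "a \<in> ?I" "c \<in> ?I" for a c
          proof -
            have "a = c \<or> (a, c) \<in> ?w \<or> (c, a) \<in> ?w"
              using w(3) I[OF that(1)] I[OF that(2)] unfolding total_on_def by blast
            then show ?thesis using Dmono by blast
          qed
        qed
        moreover have "(\<Union>a\<in>?I. D a) \<subseteq> A" using DB 1(2) by blast
        ultimately have "regular_in X (\<Union>(T ` (\<Union>a\<in>?I. D a)))" using regular_directed by blast
        moreover have "\<Union>(T ` (\<Union>a\<in>?I. D a)) = (\<Union>a\<in>?I. \<Union>(T ` D a))" by blast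
        ultimately show ?thesis by simp
      qed
    qed
    moreover have "\<Union>(T ` B) \<subseteq> (\<Union>b\<in>B. \<Union>(T ` D b))" using bD by blast
    ultimately show ?thesis by (rule resolvable_subset)
  qed
qed

end

section \<open>Inverse systems of separable metrizable spaces\<close>

definition pullback_sets :: "'a topology \<Rightarrow> 'b topology \<Rightarrow> ('a \<Rightarrow> 'b) \<Rightarrow> 'a set set" where
  "pullback_sets X Y g = {{x \<in> topspace X. g x \<in> W} | W. openin Y W}"

lemma openin_pullback_sets:
  "continuous_map X Y g \<Longrightarrow> U \<in> pullback_sets X Y g \<Longrightarrow> openin X U"
  unfolding pullback_sets_def by (auto intro: openin_continuous_map_preimage)

lemma Int_pullback_sets:
  assumes "U \<in> pullback_sets X Y g" "V \<in> pullback_sets X Y g"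
  shows "U \<inter> V \<in> pullback_sets X Y g"
proof -
  obtain W W' where W: "openin Y W" "openin Y W'"
    "U = {x \<in> topspace X. g x \<in> W}" "V = {x \<in> topspace X. g x \<in> W'}"
    using assms unfolding pullback_sets_def by blast
  have "U \<inter> V = {x \<in> topspace X. g x \<in> W \<inter> W'}" using W(3,4) by blast
  then show ?thesis using openin_Int[OF W(1,2)] unfolding pullback_sets_def by blast
qed

lemma pullback_sets_mono:
  assumes "continuous_map Y Z p" "\<And>x. x \<in> topspace X \<Longrightarrow> h x \<in> topspace Y"
    "\<And>x. x \<in> topspace X \<Longrightarrow> p (h x) = g x"
  shows "pullback_sets X Z g \<subseteq> pullback_sets X Y h"
proof
  fix U assume "U \<in> pullback_sets X Z g"
  then obtain W where W: "openin Z W" "U = {x \<in> topspace X. g x \<in> W}"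
    unfolding pullback_sets_def by blast
  have "openin Y {y \<in> topspace Y. p y \<in> W}" by (rule openin_continuous_map_preimage[OF assms(1) W(1)])
  moreover have "U = {x \<in> topspace X. h x \<in> {y \<in> topspace Y. p y \<in> W}}"
    unfolding W(2) using assms(2,3) by auto
  ultimately show "U \<in> pullback_sets X Y h" unfolding pullback_sets_def by blast
qed

text \<open>For open \<open>V\<close> the required set is the preimage of the interior of the
  closure of \<open>g\<close>
  V\<open>, nonempty because\<close>g\<open>is onto. An open\<close>W\<open>whose preimage is
  nonempty and lies in it meets that closure, and hence\<close>g \<open>V\<close>.\<close>

lemma regular_in_pullback:
  assumes g: "skeletal_map X Y g" "g ` topspace X = topspace Y"
  shows "regular_in X (pullback_sets X Y g)"
  unfolding regular_in_def
proof (intro allI impI, elim conjE)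
  fix V assume V: "openin X V" "V \<noteq> {}"
  define W0 where "W0 = Y interior_of (Y closure_of (g ` V))"
  have W0: "openin Y W0" "W0 \<noteq> {}" "W0 \<subseteq> Y closure_of (g ` V)"
    using g(1) V unfolding W0_def skeletal_map_def by (simp_all add: interior_of_subset)
  let ?U = "{x \<in> topspace X. g x \<in> W0}"
  have ne: "?U \<noteq> {}"
  proof -
    obtain y where "y \<in> W0" using W0(2) by blast
    then have "y \<in> g ` topspace X" using openin_subset[OF W0(1)] g(2) by blast
    then show ?thesis using \<open>y \<in> W0\<close> by blast
  qed
  have "U' \<inter> V \<noteq> {}" if U': "U' \<in> pullback_sets X Y g" "U' \<noteq> {}" "U' \<subseteq> ?U" for U'
  proof -
    obtain W where W: "openin Y W" "U' = {x \<in> topspace X. g x \<in> W}"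
      using U'(1) unfolding pullback_sets_def by blast
    obtain x where x: "x \<in> U'" using U'(2) by blast
    then have "g x \<in> Y closure_of (g ` V)" "g x \<in> W" using U'(3) W(2) W0(3) by blast+
    then obtain v where "v \<in> V" "g v \<in> W" using W(1) unfolding in_closure_of by blast
    then show ?thesis using W(2) openin_subset[OF V(1)] by blast
  qed
  moreover have "?U \<in> pullback_sets X Y g" using W0(1) unfolding pullback_sets_def by blast
  ultimately show "\<exists>U\<in>pullback_sets X Y g. U \<noteq> {} \<and>
      (\<forall>U'\<in>pullback_sets X Y g. U' \<noteq> {} \<and> U' \<subseteq> U \<longrightarrow> U' \<inter> V \<noteq> {})"
    using ne by (intro bexI[of _ ?U] conjI ballI impI) simp_all
qed

lemma (in Metric_space) continuous_map_dist_from: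
  assumes "q \<in> M"
  shows "continuous_map mtopology euclideanreal (d q)"
  unfolding continuous_map_upper_lower_semicontinuous_lt
proof (intro allI conjI)
  fix a
  have "{x \<in> topspace mtopology. d q x < a} = mball q a" using assms by auto
  then show "openin mtopology {x \<in> topspace mtopology. d q x < a}" by simp
  have "{x \<in> topspace mtopology. a < d q x} = topspace mtopology - mcball q a"
    using assms by auto
  then show "openin mtopology {x \<in> topspace mtopology. a < d q x}"
    using closedin_mcball by (metis openin_diff openin_topspace)
qed

text \<open>The factor two between the radii leaves room for the function
  \<open>1 / Suc n - d q z\<close> of \<open>z\<close>, positive at \<open>y\<close> and negative
  off \<open>W\<close>.\<close>

lemma (in Metric_space) small_ball_around:
  assumes D: "mtopology closure_of D = M" and W: "openin mtopology W" "y \<in> W"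
  obtains q n where "q \<in> D" "q \<in> M" "d q y < 1 / Suc n" "mball q (2 / Suc n) \<subseteq> W"
proof -
  obtain e where e: "e > 0" "mball y e \<subseteq> W" using W openin_mtopology by blast
  obtain n where n: "1 / Suc n < e / 3" using e(1) nat_approx_posE[of "e / 3"] by auto
  have "y \<in> M" using W openin_mtopology by blast
  then have "y \<in> mtopology closure_of D" using D by simp
  then obtain q where q: "q \<in> D" "q \<in> M" "d y q < 1 / Suc n"
    unfolding metric_closure_of by (auto dest!: spec[of _ "1 / Suc n"])
  have "mball q (2 / Suc n) \<subseteq> mball y e"
  proof
    fix z assume "z \<in> mball q (2 / Suc n)"
    then have z: "z \<in> M" "d q z < 2 / Suc n" by auto
    have "d y z \<le> d y q + d q z" using triangle[OF \<open>y \<in> M\<close> q(2) z(1)] .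
    also have "\<dots> < 3 * (1 / Suc n)" using q(3) z(2) by simp
    also have "\<dots> < e" using n by simp
    finally show "z \<in> mball y e" using \<open>y \<in> M\<close> z by simp
  qed
  then show thesis using that[of q n] q e(2) commute[of q y] by auto
qed

lemma countable_base_pullback:
  assumes Y: "metrizable_space Y" "separable_space Y"
    and g: "continuous_map X Y g"
  shows "\<exists>\<C>. countable \<C> \<and> \<C> \<subseteq> pullback_sets X Y g \<and>
    (\<forall>U\<in>pullback_sets X Y g. U \<noteq> {} \<longrightarrow> (\<exists>U'\<in>\<C>. U' \<noteq> {} \<and> U' \<subseteq> U))"
proof -
  obtain M d where Md: "Metric_space M d" "Y = Metric_space.mtopology M d"
    using Y(1) unfolding metrizable_space_def by blast
  interpret Metric_space M d by (rule Md(1))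
  obtain D where D: "countable D" "mtopology closure_of D = M"
    using Y(2) unfolding separable_space_def Md(2) by auto
  let ?C = "(\<lambda>(q, n). {x \<in> topspace X. g x \<in> mball q (1 / Suc n)}) ` (D \<times> (UNIV :: nat set))"
  have "countable ?C" using D(1) by (intro countable_image countable_SIGMA) simp_all
  moreover have "?C \<subseteq> pullback_sets X Y g"
  proof (rule image_subsetI, unfold pullback_sets_def Md(2), clarify)
    fix q and n :: nat
    show "\<exists>W. {x \<in> topspace X. g x \<in> mball q (1 / Suc n)} = {x \<in> topspace X. g x \<in> W} \<and>
        openin mtopology W"
      by (intro exI[of _ "mball q (1 / Suc n)"] conjI refl openin_mball)
  qed
  moreover have "\<exists>U'\<in>?C. U' \<noteq> {} \<and> U' \<subseteq> U" if U: "U \<in> pullback_sets X Y g" "U \<noteq> {}" for U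
  proof -
    obtain W where W: "openin mtopology W" "U = {x \<in> topspace X. g x \<in> W}"
      using U(1) unfolding pullback_sets_def Md(2) by blast
    obtain x where x: "x \<in> topspace X" "g x \<in> W" using U(2) W(2) by blast
    obtain q n where q: "q \<in> D" "q \<in> M" "d q (g x) < 1 / Suc n" "mball q (2 / Suc n) \<subseteq> W"
      by (rule small_ball_around[OF D(2) W(1) x(2)])
    have "g x \<in> M" using x(2) W(1) openin_mtopology by blast
    let ?U = "{x \<in> topspace X. g x \<in> mball q (1 / Suc n)}"
    have "mball q (1 / Suc n) \<subseteq> mball q (2 / Suc n)"
      by (rule mball_subset_concentric) (simp add: divide_right_mono)
    then have "mball q (1 / Suc n) \<subseteq> W" using q(4) by (rule order.trans)
    then have "?U \<subseteq> U" unfolding W(2) by auto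
    moreover have "?U \<noteq> {}" using x q \<open>g x \<in> M\<close> by auto
    moreover have "?U \<in> ?C" using q(1) by (intro image_eqI[of _ _ "(q, n)"]) simp_all
    ultimately show ?thesis by (intro bexI[of _ ?U] conjI)
  qed
  ultimately show ?thesis by (intro exI[of _ ?C]) simp
qed

text \<open>Of two disjoint sets, one contains the ball of smaller rank with twice its radius, and the
  label of the other one records that it avoids this ball.\<close>

lemma resolvable_pullback:
  fixes X :: "'a topology" and Y :: "'b topology"
  assumes Y: "metrizable_space Y" "separable_space Y"
    and g: "continuous_map X Y g" "g ` topspace X = topspace Y"
  shows "resolvable X (pullback_sets X Y g)"
proof -
  obtain M d where Md: "Metric_space M d" "Y = Metric_space.mtopology M d"
    using Y(1) unfolding metrizable_space_def by blast
  interpret Metric_space M d by (rule Md(1))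
  have gM: "g ` topspace X = M" using g(2) Md(2) by simp
  obtain D where D: "countable D" "D \<subseteq> M" "mtopology closure_of D = M"
    using Y(2) unfolding separable_space_def Md(2) by auto
  define P where "P = D \<times> (UNIV :: nat set)"
  have "countable P" unfolding P_def using D(1) by simp
  \<comment> \<open>Ranking the countably many balls leaves only finitely many of smaller rank,
    which keeps the labels below finite.\<close>
  then obtain rank :: "'b \<times> nat \<Rightarrow> nat" where rank: "inj_on rank P" by (rule countableE)
  \<comment> \<open>Clamping to the interval from -1/2 to 1/2 makes \<open>h k\<close> a literal
    without changing its sign.\<close>
  define h where "h k x = max (- 1/2) (min (1/2) (1 / Suc (snd k) - d (fst k) (g x)))"
    for k :: "'b \<times> nat" and x
  have h_lit: "h k \<in> literals X" "(\<lambda>x. - h k x) \<in> literals X" if "k \<in> P" for k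
  proof -
    have "fst k \<in> M" using that D(2) unfolding P_def by auto
    then have "continuous_map X euclideanreal (d (fst k) \<circ> g)"
      by (intro continuous_map_compose[OF g(1)]) (simp add: Md(2) continuous_map_dist_from)
    then have c: "continuous_map X euclideanreal (\<lambda>x. d (fst k) (g x))" by (simp add: o_def)
    have hc: "continuous_map X euclideanreal (h k)"
      unfolding h_def[abs_def]
      by (intro continuous_map_real_max continuous_map_real_min continuous_map_diff c) simp_all
    have b: "\<bar>h k x\<bar> \<le> 1/2" for x unfolding h_def abs_le_iff by linarith
    show "h k \<in> literals X" using hc b by (simp add: literals_def)
    show "(\<lambda>x. - h k x) \<in> literals X"
      using continuous_map_minus[OF hc] b by (simp add: literals_def)
  qed
  \<comment> \<open>\<open>N V p\<close> collects the earlier balls from which \<open>V\<close>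
    stays away. Their functions enter the label of \<open>V\<close> with a minus sign and oppose the
    labels in which those functions occur positively.\<close>
  define N where "N V p = {k \<in> P. rank k < rank p \<and> (\<forall>x\<in>V. h k x < 0)}" for V p
  define s where "s V p = insert (h p) ((\<lambda>k x. - h k x) ` N V p)" for V p
  define good where "good V p \<longleftrightarrow> p \<in> P \<and> (\<exists>W. openin mtopology W \<and> V = {x \<in> topspace X. g x \<in> W} \<and>
      mball (fst p) (2 / Suc (snd p)) \<subseteq> W)" for V p
  have fin: "finite (N V p)" for V p
  proof -
    have "inj_on rank (N V p)" using rank unfolding N_def by (rule inj_on_subset) blast
    moreover have "rank ` N V p \<subseteq> {..<rank p}" unfolding N_def by auto
    ultimately show ?thesis by (meson finite_lessThan inj_on_finite)
  qed
  have lab: "label X (s V p)" if "p \<in> P" for V p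
  proof -
    have "N V p \<subseteq> P" unfolding N_def by blast
    then have "(\<lambda>k x. - h k x) ` N V p \<subseteq> literals X" using h_lit(2) by blast
    then show ?thesis using fin h_lit(1)[OF that] unfolding label_def s_def by simp
  qed
  have opp: "opposed (s V p) (s V' p')"
    if V: "good V p" "good V' p'" "V \<inter> V' = {}" and less: "rank p < rank p'" for V V' p p'
  proof -
    obtain W where W: "p \<in> P" "V = {x \<in> topspace X. g x \<in> W}" "mball (fst p) (2 / Suc (snd p)) \<subseteq> W"
      using V(1) unfolding good_def by blast
    have "fst p \<in> M" using W(1) D(2) unfolding P_def by auto
    have "h p x < 0" if x: "x \<in> V'" for x
    proof -
      have xX: "x \<in> topspace X" using V(2) x unfolding good_def by blast
      then have "g x \<in> M" using gM by blast
      have "g x \<notin> W" using V(3) x xX W(2) by blast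
      then have "\<not> d (fst p) (g x) < 2 / Suc (snd p)" using W(3) \<open>g x \<in> M\<close> \<open>fst p \<in> M\<close> by auto
      moreover have "1 / Suc (snd p) < (2 :: real) / Suc (snd p)" by (simp add: divide_strict_right_mono)
      ultimately have "1 / Suc (snd p) - d (fst p) (g x) < 0" by linarith
      then show ?thesis unfolding h_def by auto
    qed
    then have "p \<in> N V' p'" using W(1) less unfolding N_def by blast
    then have "(\<lambda>x. - h p x) \<in> s V' p'" unfolding s_def by blast
    then show ?thesis unfolding opposed_def s_def by blast
  qed
  define E where "E = {(V, s V p) | V p. good V p}"
  show ?thesis
  proof (rule resolvableI[of E])
    show "label X t" if "(V, t) \<in> E" for V t
      using that lab unfolding E_def good_def by blast
    show "opposed t t'" if VE: "(V, t) \<in> E" "(V', t') \<in> E" and dis: "V \<inter> V' = {}" for V t V' t'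
    proof -
      obtain p p' where p: "t = s V p" "good V p" "t' = s V' p'" "good V' p'"
        using VE unfolding E_def by blast
      \<comment> \<open>With equal ranks the two sets would share a ball; its centre has a preimage
        in \<open>X\<close> by surjectivity, and that point would lie in both sets.\<close>
      have "rank p \<noteq> rank p'"
      proof
        assume "rank p = rank p'"
        then have "p = p'" using rank p unfolding good_def by (meson inj_onD)
        obtain W W' where W: "V = {x \<in> topspace X. g x \<in> W}" "V' = {x \<in> topspace X. g x \<in> W'}"
          "mball (fst p) (2 / Suc (snd p)) \<subseteq> W" "mball (fst p) (2 / Suc (snd p)) \<subseteq> W'"
          using p(2,4) \<open>p = p'\<close> unfolding good_def by blast
        have "fst p \<in> M" using p(2) D(2) unfolding good_def P_def by auto
        then have "fst p \<in> mball (fst p) (2 / Suc (snd p))" by simp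
        then have pW: "fst p \<in> W" "fst p \<in> W'" using W(3,4) by (simp_all only: subset_iff)
        from \<open>fst p \<in> M\<close> have "fst p \<in> g ` topspace X" unfolding gM .
        then obtain x where "fst p = g x" "x \<in> topspace X" by (rule imageE)
        then have "x \<in> V \<inter> V'" using pW unfolding W(1,2) by simp
        then show False using dis by simp
      qed
      then consider "rank p < rank p'" | "rank p' < rank p" by linarith
      then show ?thesis
      proof cases
        case 1
        then show ?thesis using opp[OF p(2,4) dis] p by simp
      next
        case 2
        have "V' \<inter> V = {}" using dis by blast
        from opposed_sym[OF opp[OF p(4,2) this 2]] show ?thesis using p by simp
      qed
    qed
    show "\<exists>t. (V, t) \<in> E \<and> O' \<inter> pos_set X t \<noteq> {}"
      if V: "V \<in> pullback_sets X Y g" and O': "openin X O'" "O' \<noteq> {}" "O' \<subseteq> V" for V O'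
    proof -
      obtain W where W: "openin mtopology W" "V = {x \<in> topspace X. g x \<in> W}"
        using V unfolding pullback_sets_def Md(2) by blast
      obtain x where x: "x \<in> O'" "x \<in> V" using O' by blast
      then have xW: "x \<in> topspace X" "g x \<in> W" using W(2) by blast+
      obtain q n where q: "q \<in> D" "q \<in> M" "d q (g x) < 1 / Suc n" "mball q (2 / Suc n) \<subseteq> W"
        by (rule small_ball_around[OF D(3) W(1) xW(2)])
      have gd: "good V (q, n)" using q W unfolding good_def P_def by auto
      have "0 < h (q, n) x" unfolding h_def using q(3) by simp
      moreover have "0 < - h k x" if "k \<in> N V (q, n)" for k
        using that x(2) unfolding N_def by simp
      ultimately have "x \<in> pos_set X (s V (q, n))"
        unfolding pos_set_def s_def using xW(1) by auto
      moreover have "(V, s V (q, n)) \<in> E" using gd unfolding E_def by blast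
      ultimately show ?thesis using x(1) by blast
    qed
  qed
qed

section \<open>Bases of embedded limits and cofinal sequences\<close>

lemma finite_upper_bound:
  assumes I: "directed_subset r I" "trans r" and "finite F" "F \<subseteq> I"
  shows "\<exists>j\<in>I. \<forall>i\<in>F. (i, j) \<in> r"
  using assms(3,4)
proof (induction F)
  case empty
  then show ?case using I(1) unfolding directed_subset_def by blast
next
  case (insert a F)
  then obtain j where j: "j \<in> I" "\<forall>i\<in>F. (i, j) \<in> r" by auto
  have "a \<in> I" using insert.prems by simp
  obtain k where k: "k \<in> I" "(a, k) \<in> r" "(j, k) \<in> r"
    using I(1) j(1) \<open>a \<in> I\<close> unfolding directed_subset_def by blast
  have "(i, k) \<in> r" if "i \<in> F" for i
    using j(2) that transD[OF I(2) _ k(3)] by blast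
  then show ?case using k by auto
qed

text \<open>A basic box in the product restricts only finitely many coordinates, and directedness
  gathers these into a single index from which the box is pulled back. This serves both for
  \<open>X\<close> in the full limit and for a space in the limit of a sequence.\<close>

lemma embedding_pullback_base:
  assumes e: "embedding_map X (subtopology (product_topology Y I) S) e"
    and I: "directed_subset r I" "trans r"
    and mono: "\<And>i j. i \<in> I \<Longrightarrow> j \<in> I \<Longrightarrow> (i, j) \<in> r \<Longrightarrow>
      pullback_sets X (Y i) (\<lambda>x. e x i) \<subseteq> pullback_sets X (Y j) (\<lambda>x. e x j)"
    and V: "openin X V" "x \<in> V"
  obtains i U where "i \<in> I" "U \<in> pullback_sets X (Y i) (\<lambda>x. e x i)" "x \<in> U" "U \<subseteq> V"
proof -
  let ?T = "\<lambda>i. pullback_sets X (Y i) (\<lambda>x. e x i)"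
  let ?Z = "subtopology (subtopology (product_topology Y I) S) (e ` topspace X)"
  have hom: "homeomorphic_map X ?Z e" using e unfolding embedding_map_def .
  have VX: "V \<subseteq> topspace X" by (rule openin_subset[OF V(1)])
  have "openin ?Z (e ` V)"
    using homeomorphic_imp_open_map[OF hom] V(1) unfolding open_map_def by blast
  then obtain G where G: "openin (product_topology Y I) G" "e ` V = G \<inter> (S \<inter> e ` topspace X)"
    unfolding subtopology_subtopology openin_subtopology by blast
  have inj: "inj_on e (topspace X)" by (rule homeomorphic_imp_injective_map[OF hom])
  have im: "e ` topspace X \<subseteq> topspace (product_topology Y I) \<inter> S"
  proof -
    have "topspace ?Z \<subseteq> topspace (product_topology Y I) \<inter> S"
      unfolding topspace_subtopology by blast
    with homeomorphic_imp_surjective_map[OF hom] show ?thesis by (rule ord_eq_le_trans)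
  qed
  have "e x \<in> G" using G(2) V(2) by blast
  from product_topology_open_contains_basis[OF G(1) this]
  obtain W where W: "e x \<in> Pi\<^sub>E I W" "\<forall>i. openin (Y i) (W i)"
    "finite {i. W i \<noteq> topspace (Y i)}" "Pi\<^sub>E I W \<subseteq> G"
    by (elim exE conjE)
  define F where "F = {i \<in> I. W i \<noteq> topspace (Y i)}"
  have "F \<subseteq> {i. W i \<noteq> topspace (Y i)}" "F \<subseteq> I" unfolding F_def by blast+
  then have F: "finite F" "F \<subseteq> I" using finite_subset W(3) by simp_all
  obtain j where j: "j \<in> I" "\<forall>i\<in>F. (i, j) \<in> r" using finite_upper_bound[OF I F] by blast
  define U where "U F = {y \<in> topspace X. \<forall>i\<in>F. e y i \<in> W i}" for F
  have "U F' \<in> ?T j" if "F' \<subseteq> F" for F'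
    using finite_subset[OF that F(1)] that
  proof (induction F')
    case empty
    have "e y j \<in> topspace (Y j)" if "y \<in> topspace X" for y
      using im that j(1) by (auto simp: PiE_iff)
    then have "U {} = {y \<in> topspace X. e y j \<in> topspace (Y j)}" unfolding U_def by auto
    then show ?case unfolding pullback_sets_def by blast
  next
    case (insert i F')
    have "{y \<in> topspace X. e y i \<in> W i} \<in> ?T i" unfolding pullback_sets_def using W(2) by blast
    moreover have "?T i \<subseteq> ?T j" using insert.prems F(2) j by (intro mono) auto
    ultimately have "{y \<in> topspace X. e y i \<in> W i} \<in> ?T j" by blast
    moreover have "U F' \<in> ?T j" using insert by simp
    ultimately have "{y \<in> topspace X. e y i \<in> W i} \<inter> U F' \<in> ?T j" by (rule Int_pullback_sets)
    moreover have "{y \<in> topspace X. e y i \<in> W i} \<inter> U F' = U (insert i F')" unfolding U_def by auto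
    ultimately show ?case by simp
  qed
  then have "U F \<in> ?T j" by simp
  moreover have "x \<in> U F" unfolding U_def using W(1) VX V(2) F(2) by (auto simp: PiE_iff)
  moreover have "U F \<subseteq> V"
  proof
    fix y assume y: "y \<in> U F"
    then have yX: "y \<in> topspace X" unfolding U_def by simp
    then have ey: "e y \<in> topspace (product_topology Y I)" "e y \<in> S" using im by blast+
    have "e y i \<in> W i" if "i \<in> I" for i
      using ey(1) y that unfolding U_def F_def by (cases "W i = topspace (Y i)") (auto simp: PiE_iff)
    then have "e y \<in> Pi\<^sub>E I W" using ey(1) by (auto simp: PiE_iff)
    then have "e y \<in> e ` V" using G(2) W(4) ey(2) yX by blast
    then show "y \<in> V" using inj yX VX by (metis imageE inj_onD subsetD)
  qed
  ultimately show thesis using that j(1) by blast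
qed

text \<open>Choosing \<open>s (Suc n)\<close> above \<open>s n\<close> and the \<open>n\<close>-th
  element of \<open>B\<close> reduces countable directed sets to the sequences for which suprema and
  limits are prescribed.\<close>

lemma countable_directed_cofinal_sequence:
  assumes B: "countable B" "directed_subset r B" and "trans r"
  obtains s :: "nat \<Rightarrow> 'i" where "range s \<subseteq> B" "\<And>n. (s n, s (Suc n)) \<in> r" "\<And>a. a \<in> B \<Longrightarrow> \<exists>n. (a, s n) \<in> r"
proof -
  have "B \<noteq> {}" using B(2) unfolding directed_subset_def by blast
  have "\<forall>a b. \<exists>c. a \<in> B \<and> b \<in> B \<longrightarrow> c \<in> B \<and> (a, c) \<in> r \<and> (b, c) \<in> r"
    using B(2) unfolding directed_subset_def by blast
  then obtain u where u: "\<And>a b. a \<in> B \<Longrightarrow> b \<in> B \<Longrightarrow> u a b \<in> B \<and> (a, u a b) \<in> r \<and> (b, u a b) \<in> r"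
    by metis
  let ?f = "from_nat_into B"
  have f: "?f n \<in> B" for n using \<open>B \<noteq> {}\<close> by (rule from_nat_into)
  define s where "s = rec_nat (?f 0) (\<lambda>n a. u a (?f n))"
  have s: "s (Suc n) = u (s n) (?f n)" for n by (simp add: s_def)
  have sB: "s n \<in> B" for n
  proof (induction n)
    case 0
    show ?case using f by (simp add: s_def)
  next
    case (Suc n)
    then show ?case using u f s by simp
  qed
  show thesis
  proof (rule that[of s])
    show "range s \<subseteq> B" using sB by blast
    show "(s n, s (Suc n)) \<in> r" for n using u[OF sB f] s by simp
    show "\<exists>n. (a, s n) \<in> r" if "a \<in> B" for a
    proof -
      obtain n where "a = ?f n" using from_nat_into_surj[OF B(1) \<open>a \<in> B\<close>] by metis
      then have "(a, s (Suc n)) \<in> r" using u[OF sB f] s by simp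
      then show ?thesis by blast
    qed
  qed
qed

section \<open>From a skeletal presentation to a weak kappa-metric\<close>

text \<open>The preimages under the limit projections form a \<open>sigma_directed_family\<close>
  and contain a base of \<open>X\<close>, so resolvability of their union yields the weak
  kappa-metric. The index and point types are left arbitrary.\<close>

lemma skeletal_presentation_imp_weakly_kappa_metrizable:
  fixes X :: "'a topology" and A :: "'i set" and r :: "'i rel"
    and Y :: "'i \<Rightarrow> 'b topology" and p :: "'i \<Rightarrow> 'i \<Rightarrow> 'b \<Rightarrow> 'b"
  assumes pres: "skeletal_presentation X A r Y p"
  shows "weakly_kappa_metrizable X"
proof -
  have sys: "inverse_system A r Y p"
    and Yms: "\<And>a. a \<in> A \<Longrightarrow> metrizable_space (Y a) \<and> separable_space (Y a)"
    and skel: "\<And>a b. (a, b) \<in> r \<Longrightarrow> skeletal_map (Y b) (Y a) (p b a)"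
    and sc: "sigma_complete A r"
    using pres unfolding skeletal_presentation_def by blast+
  have cts: "range s \<subseteq> A \<Longrightarrow> \<forall>n. (s n, s (Suc n)) \<in> r \<Longrightarrow> is_supremum A r (range s) b \<Longrightarrow>
      embedding_map (Y b) (inverse_limit (UNIV :: nat set) {(m, n). m \<le> n} (\<lambda>n. Y (s n)) (\<lambda>n m. p (s n) (s m)))
        (\<lambda>y n. p b (s n) y)" for s b
    using pres unfolding skeletal_presentation_def Let_def by blast
  have "\<exists>e. embedding_map X (inverse_limit A r Y p) e \<and>
      (\<forall>a\<in>A. (\<lambda>x. e x a) ` topspace X = topspace (Y a))"
    using pres unfolding skeletal_presentation_def by (elim conjE)
  then obtain e where e: "embedding_map X (inverse_limit A r Y p) e"
    "\<And>a. a \<in> A \<Longrightarrow> (\<lambda>x. e x a) ` topspace X = topspace (Y a)"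
    by auto
  have "directed_order A r" using sys unfolding inverse_system_def by simp
  then have dir: "directed_subset r A" and po: "partial_order_on A r"
    unfolding directed_order_def directed_subset_def by simp_all
  have tr: "trans r" and rf: "refl_on A r" and rA: "r \<subseteq> A \<times> A"
    using po unfolding partial_order_on_def preorder_on_def by blast+
  have pc: "continuous_map (Y b) (Y a) (p b a)" if "(a, b) \<in> r" for a b
    using skel[OF that] unfolding skeletal_map_def by blast
  define g where "g a x = e x a" for a x
  have ec: "continuous_map X (inverse_limit A r Y p) e"
    using e(1) unfolding embedding_map_def
    by (meson continuous_map_in_subtopology homeomorphic_imp_continuous_map)
  then have ec': "continuous_map X (product_topology Y A) e"
    "e ` topspace X \<subseteq> {x. \<forall>(a, b)\<in>r. p b a (x b) = x a}"
    unfolding inverse_limit_def continuous_map_in_subtopology by auto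
  have gc: "continuous_map X (Y a) (g a)" if "a \<in> A" for a
    using continuous_map_product_then_coordinatewise(1)[OF ec'(1) that] by (simp add: g_def[abs_def])
  have gs: "g a ` topspace X = topspace (Y a)" if "a \<in> A" for a
    using e(2)[OF that] by (simp add: g_def[abs_def])
  have gp: "p b a (g b x) = g a x" if "(a, b) \<in> r" "x \<in> topspace X" for a b x
    using ec'(2) that unfolding g_def by blast
  define T where "T a = pullback_sets X (Y a) (g a)" for a
  have Tmono: "T a \<subseteq> T b" if "(a, b) \<in> r" for a b
    unfolding T_def
  proof (rule pullback_sets_mono[OF pc[OF that]])
    have "b \<in> A" using rA that by blast
    then show "g b x \<in> topspace (Y b)" if "x \<in> topspace X" for x using gs that by blast
  qed (rule gp[OF that])
  have base: "\<exists>a\<in>A. \<exists>U\<in>T a. U \<noteq> {} \<and> U \<subseteq> V" if V: "openin X V" "V \<noteq> {}" for V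
  proof -
    obtain x where "x \<in> V" using V(2) by blast
    have m: "pullback_sets X (Y i) (\<lambda>x. e x i) \<subseteq> pullback_sets X (Y j) (\<lambda>x. e x j)"
      if "i \<in> A" "j \<in> A" "(i, j) \<in> r" for i j
      using Tmono[OF that(3)] unfolding T_def g_def .
    obtain a U where "a \<in> A" "U \<in> pullback_sets X (Y a) (\<lambda>x. e x a)" "x \<in> U" "U \<subseteq> V"
      by (rule embedding_pullback_base[OF e(1)[unfolded inverse_limit_def] dir tr m V(1) \<open>x \<in> V\<close>])
    then show ?thesis unfolding T_def g_def by blast
  qed
  \<comment> \<open>A nonempty open \<open>V\<close> contains the preimage of an open
    \<open>W\<close> at some \<open>c\<close> above \<open>a\<close>. As \<open>g c\<close> is onto,
    \<open>p c a\<close> W\<open>lies in\<close>g a \<open>V\<close>, and skeletality of the bonding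
    map carries over to the projection.\<close>
  have gskel: "skeletal_map X (Y a) (g a)" if a: "a \<in> A" for a
    unfolding skeletal_map_def
  proof (intro conjI gc[OF a] allI impI, elim conjE)
    fix V assume V: "openin X V" "V \<noteq> {}"
    obtain b U where b: "b \<in> A" "U \<in> T b" "U \<noteq> {}" "U \<subseteq> V" using base[OF V] by blast
    obtain c where c: "c \<in> A" "(a, c) \<in> r" "(b, c) \<in> r"
      using dir a b(1) unfolding directed_subset_def by blast
    have "U \<in> T c" using Tmono[OF c(3)] b(2) by blast
    then obtain W where W: "openin (Y c) W" "U = {x \<in> topspace X. g c x \<in> W}"
      unfolding T_def pullback_sets_def by blast
    have "W \<noteq> {}" using b(3) W(2) by blast
    have "p c a ` W \<subseteq> g a ` V"
    proof
      fix z assume "z \<in> p c a ` W"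
      then obtain w where w: "w \<in> W" "z = p c a w" by blast
      then have "w \<in> g c ` topspace X" using openin_subset[OF W(1)] gs[OF c(1)] by blast
      then obtain x where x: "x \<in> topspace X" "w = g c x" by blast
      then have "x \<in> V" using w(1) W(2) b(4) by blast
      moreover have "z = g a x" using gp[OF c(2) x(1)] w(2) x(2) by simp
      ultimately show "z \<in> g a ` V" by blast
    qed
    then have "Y a interior_of (Y a closure_of (p c a ` W)) \<subseteq> Y a interior_of (Y a closure_of (g a ` V))"
      by (intro interior_of_mono closure_of_mono)
    moreover have "Y a interior_of (Y a closure_of (p c a ` W)) \<noteq> {}"
      using skel[OF c(2)] W(1) \<open>W \<noteq> {}\<close> unfolding skeletal_map_def by blast
    ultimately show "Y a interior_of (Y a closure_of (g a ` V)) \<noteq> {}" by blast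
  qed
  \<comment> \<open>The supremum \<open>b\<close> of a cofinal sequence bounds \<open>B\<close>.
    Since \<open>Y b\<close> embeds in the limit of the sequence, each point of an open set of
    \<open>Y b\<close> has a smaller neighbourhood pulled back from some
    \<open>Y (s n)\<close>.\<close>
  have sup: "\<exists>b\<in>A. (\<forall>a\<in>B. (a, b) \<in> r) \<and>
        (\<forall>U\<in>T b. U \<noteq> {} \<longrightarrow> (\<exists>U'\<in>\<Union>(T ` B). U' \<noteq> {} \<and> U' \<subseteq> U))"
    if B: "countable B" "B \<subseteq> A" "directed_subset r B" for B
  proof -
    obtain s :: "nat \<Rightarrow> 'i" where s: "range s \<subseteq> B" "\<And>n. (s n, s (Suc n)) \<in> r"
      "\<And>a. a \<in> B \<Longrightarrow> \<exists>n. (a, s n) \<in> r"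
      by (rule countable_directed_cofinal_sequence[OF B(1,3) tr]) (rule that)
    have sA: "s n \<in> A" for n using s(1) B(2) by blast
    have smono: "(s m, s n) \<in> r" if "m \<le> n" for m n
      using that
    proof (induction rule: dec_induct)
      case base
      show ?case using rf sA by (auto dest: refl_onD)
    next
      case (step n)
      show ?case by (rule transD[OF tr step.IH s(2)])
    qed
    have "range s \<in> Chains r"
      unfolding Chains_def using smono by (auto intro: nat_le_linear[THEN disjE])
    then obtain b where b: "is_supremum A r (range s) b"
      using sc s(1) B(2) unfolding sigma_complete_def
      by (metis countable_image countableI_type empty_not_UNIV image_is_empty order.trans)
    then have bA: "b \<in> A" and sb: "\<And>n. (s n, b) \<in> r" unfolding is_supremum_def by blast+
    have Bb: "(a, b) \<in> r" if "a \<in> B" for a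
    proof -
      obtain n where "(a, s n) \<in> r" using s(3)[OF \<open>a \<in> B\<close>] by blast
      then show ?thesis using sb[of n] by (rule transD[OF tr])
    qed
    let ?h = "\<lambda>y n. p b (s n) y"
    have emb: "embedding_map (Y b) (inverse_limit (UNIV :: nat set) {(m, n). m \<le> n}
        (\<lambda>n. Y (s n)) (\<lambda>n m. p (s n) (s m))) ?h"
      using cts[of s b] s B(2) b by blast
    have comp: "p c a (p b' c y) = p b' a y" if "(a, c) \<in> r" "(c, b') \<in> r" "y \<in> topspace (Y b')" for a c b' y
      using sys that unfolding inverse_system_def by blast
    have m: "pullback_sets (Y b) (Y (s i)) (\<lambda>y. ?h y i) \<subseteq> pullback_sets (Y b) (Y (s j)) (\<lambda>y. ?h y j)"
      if ij: "(i, j) \<in> {(m, n). m \<le> n}" for i j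
    proof (rule pullback_sets_mono[OF pc])
      show "(s i, s j) \<in> r" using smono ij by blast
      show "p b (s j) y \<in> topspace (Y (s j))" if "y \<in> topspace (Y b)" for y
        using pc[OF sb[of j]] that by (meson continuous_map_image_subset_topspace image_subset_iff)
      show "p (s j) (s i) (p b (s j) y) = p b (s i) y" if "y \<in> topspace (Y b)" for y
        by (rule comp[OF _ sb that]) (use smono ij in blast)
    qed
    have "\<exists>U'\<in>\<Union>(T ` B). U' \<noteq> {} \<and> U' \<subseteq> U" if U: "U \<in> T b" "U \<noteq> {}" for U
    proof -
      obtain W where W: "openin (Y b) W" "U = {x \<in> topspace X. g b x \<in> W}"
        using U(1) unfolding T_def pullback_sets_def by blast
      obtain x where x: "x \<in> topspace X" "g b x \<in> W" using U(2) W(2) by blast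
      have dn: "directed_subset {(m, n). m \<le> n} (UNIV :: nat set)"
        unfolding directed_subset_def by (auto intro: max.cobounded1 max.cobounded2)
      have tn: "trans {(m :: nat, n). m \<le> n}" by (auto simp: trans_def)
      obtain n V where V: "V \<in> pullback_sets (Y b) (Y (s n)) (\<lambda>y. ?h y n)" "g b x \<in> V" "V \<subseteq> W"
        by (rule embedding_pullback_base[OF emb[unfolded inverse_limit_def] dn tn m W(1) x(2)])
      obtain Q where Q: "openin (Y (s n)) Q" "V = {y \<in> topspace (Y b). p b (s n) y \<in> Q}"
        using V(1) unfolding pullback_sets_def by blast
      let ?U = "{z \<in> topspace X. g (s n) z \<in> Q}"
      have "?U \<in> T (s n)" unfolding T_def pullback_sets_def using Q(1) by blast
      then have 1: "?U \<in> \<Union>(T ` B)" using s(1) by blast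
      have 2: "x \<in> ?U" using V(2) Q(2) x(1) gp[OF sb[of n] x(1)] by simp
      have 3: "?U \<subseteq> U"
      proof
        fix z assume z: "z \<in> ?U"
        then have "g b z \<in> topspace (Y b)" using gs[OF bA] by blast
        then have "g b z \<in> V" using z Q(2) gp[OF sb[of n], of z] by simp
        then show "z \<in> U" using V(3) W(2) z by blast
      qed
      show ?thesis by (rule bexI[OF _ 1]) (use 2 3 in blast)
    qed
    then show ?thesis using bA Bb by (intro bexI[of _ b]) simp_all
  qed
  interpret sigma_directed_family X A r T
  proof
    show "T a \<subseteq> T b" if "(a, b) \<in> r" for a b by (rule Tmono[OF that])
    fix a assume a: "a \<in> A"
    show "openin X U" if "U \<in> T a" for U
      using openin_pullback_sets[OF gc[OF a]] that unfolding T_def .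
    show "U \<inter> V \<in> T a" if "U \<in> T a" "V \<in> T a" for U V
      using Int_pullback_sets that unfolding T_def .
    show "resolvable X (T a)"
      unfolding T_def using resolvable_pullback gc[OF a] gs[OF a] Yms[OF a] by blast
    show "regular_in X (T a)"
      unfolding T_def using regular_in_pullback gskel[OF a] gs[OF a] by blast
    show "\<exists>\<C>. countable \<C> \<and> \<C> \<subseteq> T a \<and> (\<forall>U\<in>T a. U \<noteq> {} \<longrightarrow> (\<exists>U'\<in>\<C>. U' \<noteq> {} \<and> U' \<subseteq> U))"
      unfolding T_def using Yms[OF a] gc[OF a] by (intro countable_base_pullback) simp_all
  qed (rule sup)
  show ?thesis
  proof (rule resolvable_imp_weakly_kappa_metrizable)
    show "resolvable X (\<Union>(T ` A))" by (rule resolvable_directed[OF order.refl dir])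
    show "\<exists>U\<in>\<Union>(T ` A). openin X U \<and> U \<noteq> {} \<and> U \<subseteq> W" if "openin X W" "W \<noteq> {}" for W
      using base[OF that] op by blast
  qed
qed

section \<open>Quotients of a weakly kappa-metrizable compact space\<close>

definition cylinder :: "'a topology \<Rightarrow> (('a \<Rightarrow> real) \<times> real \<times> real) set set \<Rightarrow> 'a set" where
  "cylinder X \<G> = {x \<in> topspace X. \<exists>G\<in>\<G>. \<forall>(f, a, b)\<in>G. a < f x \<and> f x < b}"

text \<open>Rational bounds keep the family countable for countable \<open>P\<close>, and the outer
  \<open>Fpow\<close> makes it closed under finite unions; together these allow an open set to be
  exhausted by an increasing sequence of cylinders.\<close>

definition cylinders :: "'a topology \<Rightarrow> ('a \<Rightarrow> real) set \<Rightarrow> 'a set set" where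
  "cylinders X P = cylinder X ` Fpow (Fpow (P \<times> \<rat> \<times> \<rat>))"

text \<open>The diagonal map of \<open>P\<close>, read through an enumeration. A finite nonempty
  \<open>P\<close> is enumerated with repetitions, so all target spaces live in
  \<open>nat \<Rightarrow> real\<close>.\<close>

definition eval_map :: "('a \<Rightarrow> real) set \<Rightarrow> 'a \<Rightarrow> nat \<Rightarrow> real" where
  "eval_map P x n = from_nat_into P n x"

definition eval_space :: "'a topology \<Rightarrow> ('a \<Rightarrow> real) set \<Rightarrow> (nat \<Rightarrow> real) topology" where
  "eval_space X P = top_of_set (eval_map P ` topspace X)"

text \<open>The projection that forgets the functions outside \<open>P\<close>: coordinate
  \<open>n\<close> for \<open>P\<close> is looked up at the place its function has in the
  enumeration of \<open>Q\<close>.\<close>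

definition reindex :: "('a \<Rightarrow> real) set \<Rightarrow> ('a \<Rightarrow> real) set \<Rightarrow> (nat \<Rightarrow> real) \<Rightarrow> nat \<Rightarrow> real" where
  "reindex Q P y n = y (to_nat_on Q (from_nat_into P n))"

lemma countable_cylinders: "countable P \<Longrightarrow> countable (cylinders X P)"
  unfolding cylinders_def
  by (intro countable_image countable_Fpow countable_SIGMA countable_rat)

lemma empty_in_cylinders: "{} \<in> cylinders X P"
  unfolding cylinders_def by (rule image_eqI[of _ _ "{}"]) (auto simp: cylinder_def Fpow_def)

lemma Un_in_cylinders:
  assumes "V \<in> cylinders X P" "W \<in> cylinders X P"
  shows "V \<union> W \<in> cylinders X P"
proof -
  obtain \<G> \<H> where G: "\<G> \<in> Fpow (Fpow (P \<times> \<rat> \<times> \<rat>))" "V = cylinder X \<G>"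
    "\<H> \<in> Fpow (Fpow (P \<times> \<rat> \<times> \<rat>))" "W = cylinder X \<H>"
    using assms unfolding cylinders_def by blast
  have "\<G> \<union> \<H> \<in> Fpow (Fpow (P \<times> \<rat> \<times> \<rat>))" using G(1,3) unfolding Fpow_def[of "Fpow _"] by blast
  moreover have "V \<union> W = cylinder X (\<G> \<union> \<H>)" unfolding G(2,4) cylinder_def by blast
  ultimately show ?thesis unfolding cylinders_def by blast
qed

lemma openin_cylinders:
  assumes P: "\<And>f. f \<in> P \<Longrightarrow> continuous_map X euclideanreal f" and W: "W \<in> cylinders X P"
  shows "openin X W"
proof -
  obtain \<G> where G: "\<And>G. G \<in> \<G> \<Longrightarrow> finite G \<and> G \<subseteq> P \<times> \<rat> \<times> \<rat>" "W = cylinder X \<G>"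
    using W unfolding cylinders_def Fpow_def by blast
  have "openin X {x \<in> topspace X. \<forall>(f, a, b)\<in>G. a < f x \<and> f x < b}" if "G \<in> \<G>" for G
  proof -
    have "finite G" "G \<subseteq> P \<times> \<rat> \<times> \<rat>" using G(1)[OF that] by simp_all
    then show ?thesis
    proof (induction G)
      case (insert t G)
      obtain f a b where t: "t = (f, a, b)" by (cases t)
      have "continuous_map X euclideanreal f" using P insert.prems t by auto
      then have "openin X ({x \<in> topspace X. a < f x} \<inter> {x \<in> topspace X. f x < b})"
        unfolding continuous_map_upper_lower_semicontinuous_lt by (intro openin_Int) simp_all
      then have "openin X (({x \<in> topspace X. a < f x} \<inter> {x \<in> topspace X. f x < b}) \<inter>
          {x \<in> topspace X. \<forall>(f, a, b)\<in>G. a < f x \<and> f x < b})"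
        by (rule openin_Int) (use insert in simp_all)
      moreover have "({x \<in> topspace X. a < f x} \<inter> {x \<in> topspace X. f x < b}) \<inter>
          {x \<in> topspace X. \<forall>(f, a, b)\<in>G. a < f x \<and> f x < b} =
          {x \<in> topspace X. \<forall>(f, a, b)\<in>insert t G. a < f x \<and> f x < b}"
        unfolding t by auto
      ultimately show ?case by simp
    qed simp
  qed
  then have "openin X (\<Union>G\<in>\<G>. {x \<in> topspace X. \<forall>(f, a, b)\<in>G. a < f x \<and> f x < b})" by blast
  moreover have "(\<Union>G\<in>\<G>. {x \<in> topspace X. \<forall>(f, a, b)\<in>G. a < f x \<and> f x < b}) = W"
    unfolding G(2) cylinder_def by blast
  ultimately show ?thesis by simp
qed

text \<open>A cylinder mentions only finitely many functions, and a member of the chain contains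
  them all.\<close>

lemma cylinders_Union_chain:
  assumes ne: "\<C> \<noteq> {}" and chain: "\<And>P Q. P \<in> \<C> \<Longrightarrow> Q \<in> \<C> \<Longrightarrow> P \<subseteq> Q \<or> Q \<subseteq> P"
    and W: "W \<in> cylinders X (\<Union>\<C>)"
  shows "\<exists>P\<in>\<C>. W \<in> cylinders X P"
proof -
  obtain \<G> where G: "finite \<G>" "\<And>G. G \<in> \<G> \<Longrightarrow> finite G" "\<And>G. G \<in> \<G> \<Longrightarrow> G \<subseteq> \<Union>\<C> \<times> \<rat> \<times> \<rat>"
    "W = cylinder X \<G>"
    using W unfolding cylinders_def Fpow_def by blast
  have fin: "finite (fst ` \<Union>\<G>)" using G(1,2) by blast
  have sub: "fst ` \<Union>\<G> \<subseteq> \<Union>\<C>" using G(3) by fastforce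
  have "subset.chain UNIV \<C>" unfolding subset_chain_def using chain by blast
  then obtain P where P: "P \<in> \<C>" "fst ` \<Union>\<G> \<subseteq> P"
    using finite_subset_Union_chain[OF fin sub ne] by blast
  have "G \<in> Fpow (P \<times> \<rat> \<times> \<rat>)" if "G \<in> \<G>" for G
  proof -
    have "t \<in> P \<times> \<rat> \<times> \<rat>" if "t \<in> G" for t
    proof -
      have "fst t \<in> P" using P(2) \<open>t \<in> G\<close> \<open>G \<in> \<G>\<close> by blast
      moreover have "t \<in> \<Union>\<C> \<times> \<rat> \<times> \<rat>" using G(3)[OF \<open>G \<in> \<G>\<close>] \<open>t \<in> G\<close> by blast
      ultimately show ?thesis by (simp add: mem_Times_iff)
    qed
    then show ?thesis using G(2)[OF that] unfolding Fpow_def by blast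
  qed
  then have "\<G> \<in> Fpow (Fpow (P \<times> \<rat> \<times> \<rat>))" using G(1) unfolding Fpow_def[of "Fpow _"] by blast
  then show ?thesis using P(1) G(4) unfolding cylinders_def by blast
qed

lemma cylinder_base:
  assumes P: "P \<noteq> {}" and x: "x \<in> topspace X" and G: "open G" "eval_map P x \<in> G"
  shows "\<exists>W\<in>cylinders X P. x \<in> W \<and> (\<forall>y\<in>W. eval_map P y \<in> G)"
proof -
  have "openin (product_topology (\<lambda>_. euclideanreal) (UNIV :: nat set)) G"
    using G(1) by (simp add: euclidean_product_topology)
  from product_topology_open_contains_basis[OF this G(2)]
  obtain B where B: "eval_map P x \<in> Pi\<^sub>E UNIV B" "\<forall>i. open (B i)" "finite {i. B i \<noteq> UNIV}" "Pi\<^sub>E UNIV B \<subseteq> G"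
    by (auto simp del: PiE_UNIV_domain)
  have "\<exists>a b. a \<in> \<rat> \<and> b \<in> \<rat> \<and> a < eval_map P x i \<and> eval_map P x i < b \<and> {a<..<b} \<subseteq> B i" for i
  proof -
    have "eval_map P x i \<in> B i" using B(1) by (auto simp: PiE_iff)
    then obtain e where e: "e > 0" "\<And>z. dist z (eval_map P x i) < e \<Longrightarrow> z \<in> B i"
      using B(2) unfolding open_dist by blast
    obtain a where a: "a \<in> \<rat>" "eval_map P x i - e < a" "a < eval_map P x i"
      using Rats_dense_in_real[of "eval_map P x i - e" "eval_map P x i"] e(1) by auto
    obtain b where b: "b \<in> \<rat>" "eval_map P x i < b" "b < eval_map P x i + e"
      using Rats_dense_in_real[of "eval_map P x i" "eval_map P x i + e"] e(1) by auto
    have "{a<..<b} \<subseteq> B i" using e(2) a b by (auto simp: dist_real_def)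
    then show ?thesis using a b by blast
  qed
  then obtain a b where ab: "\<And>i. a i \<in> \<rat>" "\<And>i. b i \<in> \<rat>" "\<And>i. a i < eval_map P x i"
    "\<And>i. eval_map P x i < b i" "\<And>i. {a i<..<b i} \<subseteq> B i"
    by metis
  define H where "H = (\<lambda>i. (from_nat_into P i, a i, b i)) ` {i. B i \<noteq> UNIV}"
  have "H \<subseteq> P \<times> \<rat> \<times> \<rat>" unfolding H_def using ab(1,2) from_nat_into[OF P] by blast
  moreover have "finite H" unfolding H_def using B(3) by simp
  ultimately have "{H} \<in> Fpow (Fpow (P \<times> \<rat> \<times> \<rat>))" by (simp add: Fpow_def)
  then have 1: "cylinder X {H} \<in> cylinders X P" unfolding cylinders_def by blast
  have 2: "x \<in> cylinder X {H}" unfolding cylinder_def H_def using x ab(3,4) by (auto simp: eval_map_def)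
  have 3: "eval_map P y \<in> G" if "y \<in> cylinder X {H}" for y
  proof -
    have "eval_map P y i \<in> B i" for i
    proof (cases "B i = UNIV")
      case False
      then have "(from_nat_into P i, a i, b i) \<in> H" unfolding H_def by blast
      then have "a i < eval_map P y i \<and> eval_map P y i < b i"
        using that unfolding cylinder_def eval_map_def by fastforce
      then show ?thesis using ab(5)[of i] by auto
    qed simp
    then show ?thesis using B(4) by (auto simp: PiE_iff)
  qed
  show ?thesis by (rule bexI[OF _ 1]) (use 2 3 in blast)
qed

lemma continuous_map_into_eval_space:
  assumes "\<And>n. continuous_map Z euclideanreal (\<lambda>z. h z n)" "h ` topspace Z \<subseteq> eval_map P ` topspace X"
  shows "continuous_map Z (eval_space X P) h"
proof -
  have "continuous_map Z (product_topology (\<lambda>_. euclideanreal) UNIV) h"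
    unfolding continuous_map_componentwise_UNIV using assms(1) by simp
  then show ?thesis
    using assms(2) unfolding eval_space_def continuous_map_in_subtopology euclidean_product_topology
    by blast
qed

lemma continuous_map_eval_map:
  assumes "P \<noteq> {}" "\<And>f. f \<in> P \<Longrightarrow> continuous_map X euclideanreal f"
  shows "continuous_map X (eval_space X P) (eval_map P)"
proof (rule continuous_map_into_eval_space)
  show "continuous_map X euclideanreal (\<lambda>x. eval_map P x n)" for n
    unfolding eval_map_def using assms(2)[OF from_nat_into[OF assms(1), of n]] by simp
qed simp

lemma topspace_eval_space: "topspace (eval_space X P) = eval_map P ` topspace X"
  by (simp add: eval_space_def)

lemma Hausdorff_eval_space: "Hausdorff_space (eval_space X P)"
  unfolding eval_space_def by (intro Hausdorff_space_subtopology) simp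

lemma metrizable_eval_space: "metrizable_space (eval_space X P)"
  unfolding eval_space_def
  by (intro metrizable_space_subtopology metrizable_space_euclidean)

lemma separable_eval_space: "separable_space (eval_space X P)"
proof -
  have "second_countable (euclidean :: (nat \<Rightarrow> real) topology)"
  proof -
    obtain \<B> :: "(nat \<Rightarrow> real) set set" where B: "countable \<B>" "\<And>C. C \<in> \<B> \<Longrightarrow> open C"
      "\<And>S. open S \<Longrightarrow> \<exists>U. U \<subseteq> \<B> \<and> S = \<Union>U"
      by (rule univ_second_countable) (rule that)
    have "\<exists>V\<in>\<B>. x \<in> V \<and> V \<subseteq> U" if "open U" "x \<in> U" for U x
      using B(3)[OF that(1)] that(2) by auto
    then show ?thesis
      unfolding second_countable_def using B(1,2) by (intro exI[of _ \<B>]) simp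
  qed
  then show ?thesis
    unfolding eval_space_def
    by (intro second_countable_imp_separable_space second_countable_subtopology)
qed

lemma compact_eval_space:
  assumes "compact_space X" "continuous_map X (eval_space X P) (eval_map P)"
  shows "compact_space (eval_space X P)"
  using image_compactin[of X "topspace X" "eval_space X P" "eval_map P"] assms
  by (simp add: compact_space_def topspace_eval_space)

lemma reindex_eval_map:
  assumes "countable Q" "P \<subseteq> Q" "P \<noteq> {}"
  shows "reindex Q P (eval_map Q x) = eval_map P x"
proof
  fix n
  have "from_nat_into P n \<in> Q" using from_nat_into[OF assms(3)] assms(2) by blast
  then show "reindex Q P (eval_map Q x) n = eval_map P x n"
    unfolding reindex_def eval_map_def using from_nat_into_to_nat_on[OF assms(1)] by simp
qed

lemma continuous_map_reindex:
  assumes "countable Q" "P \<subseteq> Q" "P \<noteq> {}"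
  shows "continuous_map (eval_space X Q) (eval_space X P) (reindex Q P)"
proof (rule continuous_map_into_eval_space)
  have "continuous_map (product_topology (\<lambda>_. euclideanreal) UNIV) euclideanreal (\<lambda>z :: nat \<Rightarrow> real. z k)" for k
    by (rule continuous_map_product_projection) simp
  then show "continuous_map (eval_space X Q) euclideanreal (\<lambda>z. reindex Q P z n)" for n
    unfolding reindex_def eval_space_def euclidean_product_topology
    by (rule continuous_map_from_subtopology)
  show "reindex Q P ` topspace (eval_space X Q) \<subseteq> eval_map P ` topspace X"
    unfolding topspace_eval_space using reindex_eval_map[OF assms] by auto
qed

lemma eval_map_eq_iff:
  assumes "countable P" "P \<noteq> {}"
  shows "eval_map P x = eval_map P y \<longleftrightarrow> (\<forall>f\<in>P. f x = f y)"
proof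
  assume eq: "eval_map P x = eval_map P y"
  show "\<forall>f\<in>P. f x = f y"
  proof
    fix f assume "f \<in> P"
    then obtain n where "from_nat_into P n = f" using from_nat_into_surj[OF assms(1)] by blast
    then show "f x = f y" using fun_cong[OF eq, of n] by (simp add: eval_map_def)
  qed
next
  assume "\<forall>f\<in>P. f x = f y"
  then show "eval_map P x = eval_map P y"
    using from_nat_into[OF assms(2)] by (auto simp: eval_map_def)
qed

section \<open>K4 for increasing sequences, and admissible sets of functions\<close>

text \<open>K4 takes its index set among sets of subsets of \<open>X\<close>. A sequence may repeat
  terms, so its range serves as index set; least indices turn strict inclusion into the order of the
  natural numbers.\<close>

lemma well_order_on_range_incseq:
  fixes C :: "nat \<Rightarrow> 'a set"
  assumes "incseq C"
  shows "well_order_on (range C) {(a, b). a \<in> range C \<and> b \<in> range C \<and> a \<subseteq> b}"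
proof -
  let ?r = "{(a, b). a \<in> range C \<and> b \<in> range C \<and> a \<subseteq> b}"
  have tot: "a \<subseteq> b \<or> b \<subseteq> a" if ab: "a \<in> range C" "b \<in> range C" for a b
  proof -
    obtain m n where "a = C m" "b = C n" using ab by blast
    then show ?thesis using incseqD[OF assms, of m n] incseqD[OF assms, of n m] by (cases "m \<le> n") simp_all
  qed
  define \<iota> where "\<iota> a = (LEAST n. C n = a)" for a
  have \<iota>: "C (\<iota> a) = a" if "a \<in> range C" for a
    unfolding \<iota>_def using that by (metis (mono_tags, lifting) LeastI rangeE)
  have "?r - Id \<subseteq> inv_image less_than \<iota>"
  proof
    fix t assume "t \<in> ?r - Id"
    then obtain a b where t: "t = (a, b)" "a \<in> range C" "b \<in> range C" "a \<subseteq> b" "a \<noteq> b" by blast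
    have "\<not> \<iota> b \<le> \<iota> a"
    proof
      assume "\<iota> b \<le> \<iota> a"
      then have "C (\<iota> b) \<subseteq> C (\<iota> a)" by (rule incseqD[OF assms])
      then show False using \<iota> t by simp
    qed
    then show "t \<in> inv_image less_than \<iota>" using t(1) by simp
  qed
  then have "wf (?r - Id)" by (rule wf_subset[OF wf_inv_image[OF wf_less_than]])
  moreover have "linear_order_on (range C) ?r"
    unfolding linear_order_on_def partial_order_on_def preorder_on_def
  proof (intro conjI)
    show "total_on (range C) ?r" unfolding total_on_def using tot by blast
  qed (auto simp: refl_on_def trans_def antisym_def)
  ultimately show ?thesis unfolding well_order_on_def by simp
qed

lemma weak_kappa_metricD:
  assumes "weak_kappa_metric X d"
  shows "\<And>x C. x \<in> topspace X \<Longrightarrow> C \<in> regularly_closed X \<Longrightarrow> 0 \<le> d x C"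
    and "\<And>C. C \<in> regularly_closed X \<Longrightarrow> \<exists>V. openin (subtopology X (topspace X - C)) V \<and>
        subtopology X (topspace X - C) closure_of V = topspace X - C \<and>
        (\<forall>x\<in>topspace X. 0 < d x C \<longleftrightarrow> x \<in> V)"
    and "\<And>x C C'. C \<in> regularly_closed X \<Longrightarrow> C' \<in> regularly_closed X \<Longrightarrow> C \<subseteq> C' \<Longrightarrow>
        x \<in> topspace X \<Longrightarrow> d x C' \<le> d x C"
    and "\<And>C. C \<in> regularly_closed X \<Longrightarrow> continuous_map X euclideanreal (\<lambda>x. d x C)"
  using assms unfolding weak_kappa_metric_def by simp_all

lemma weak_kappa_metric_INF:
  fixes X :: "'a topology" and I :: "'a set set"
  assumes "weak_kappa_metric X d" "I \<noteq> {}" "well_order_on I r"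
    "\<And>i. i \<in> I \<Longrightarrow> i \<in> regularly_closed X" "\<And>i j. (i, j) \<in> r \<Longrightarrow> i \<subseteq> j"
  shows "continuous_map X euclideanreal (\<lambda>x. INF i\<in>I. d x i)"
proof -
  have "\<forall>(I :: 'a set set) r F. I \<noteq> {} \<and> well_order_on I r \<and> (\<forall>i\<in>I. F i \<in> regularly_closed X) \<and>
      (\<forall>(i, j)\<in>r. F i \<subseteq> F j) \<longrightarrow> continuous_map X euclideanreal (\<lambda>x. INF i\<in>I. d x (F i))"
    using assms(1) unfolding weak_kappa_metric_def by (elim conjE)
  from this[rule_format, of I r "\<lambda>i. i"] show ?thesis using assms(2-) by auto
qed

text \<open>The closure condition makes every \<open>d x (X closure_of W)\<close> with
  \<open>W\<close> a cylinder over \<open>P\<close> constant on the fibres of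
  \<open>eval_map P\<close>.\<close>

definition admissible :: "'a topology \<Rightarrow> ('a \<Rightarrow> 'a set \<Rightarrow> real) \<Rightarrow> ('a \<Rightarrow> real) set set" where
  "admissible X d = {P. P \<noteq> {} \<and> countable P \<and> (\<forall>f\<in>P. continuous_map X euclideanreal f) \<and>
     (\<forall>W\<in>cylinders X P. (\<lambda>x. d x (X closure_of W)) \<in> P)}"

lemma admissibleD:
  assumes "P \<in> admissible X d"
  shows "P \<noteq> {}" "countable P" "\<And>f. f \<in> P \<Longrightarrow> continuous_map X euclideanreal f"
    "\<And>W. W \<in> cylinders X P \<Longrightarrow> (\<lambda>x. d x (X closure_of W)) \<in> P"
  using assms unfolding admissible_def by simp_all

lemma admissible_Union_chain:
  assumes "\<C> \<noteq> {}" "countable \<C>" "\<C> \<subseteq> admissible X d"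
    and chain: "\<And>P Q. P \<in> \<C> \<Longrightarrow> Q \<in> \<C> \<Longrightarrow> P \<subseteq> Q \<or> Q \<subseteq> P"
  shows "\<Union>\<C> \<in> admissible X d"
proof -
  have adm: "P \<in> admissible X d" if "P \<in> \<C>" for P using assms(3) that by blast
  obtain P0 where P0: "P0 \<in> \<C>" using assms(1) by blast
  have "\<Union>\<C> \<noteq> {}" using admissibleD(1)[OF adm[OF P0]] P0 by blast
  moreover have "countable (\<Union>\<C>)"
    using countable_UN[of \<C> "\<lambda>P. P"] assms(2) admissibleD(2)[OF adm] by simp
  moreover have "continuous_map X euclideanreal f" if "f \<in> \<Union>\<C>" for f
  proof -
    obtain P where "P \<in> \<C>" "f \<in> P" using \<open>f \<in> \<Union>\<C>\<close> by blast
    then show ?thesis using admissibleD(3)[OF adm] by simp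
  qed
  moreover have "(\<lambda>x. d x (X closure_of W)) \<in> \<Union>\<C>" if "W \<in> cylinders X (\<Union>\<C>)" for W
  proof -
    obtain P where "P \<in> \<C>" "W \<in> cylinders X P"
      using cylinders_Union_chain[OF assms(1) chain \<open>W \<in> cylinders X (\<Union>\<C>)\<close>] by blast
    then show ?thesis using admissibleD(4)[OF adm] by blast
  qed
  ultimately show ?thesis unfolding admissible_def by simp
qed

text \<open>Countably many rounds of adding the distance functions suffice, because each cylinder
  over the union already lives at a finite round.\<close>

lemma admissible_cofinal:
  assumes d: "weak_kappa_metric X d"
    and S: "countable S" "\<And>f. f \<in> S \<Longrightarrow> continuous_map X euclideanreal f"
  shows "\<exists>P\<in>admissible X d. S \<subseteq> P"
proof -
  define step where "step Q = Q \<union> (\<lambda>W x. d x (X closure_of W)) ` cylinders X Q" for Q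
  \<comment> \<open>The zero function keeps the starting set nonempty when \<open>S\<close> is
    empty.\<close>
  define Q where "Q n = (step ^^ n) (insert (\<lambda>_. 0) S)" for n
  have Q_Suc: "Q (Suc n) = step (Q n)" for n by (simp add: Q_def)
  have Q: "countable (Q n) \<and> (\<forall>f\<in>Q n. continuous_map X euclideanreal f)" for n
  proof (induction n)
    case 0
    show ?case using S by (simp add: Q_def)
  next
    case (Suc n)
    have "continuous_map X euclideanreal (\<lambda>x. d x (X closure_of W))" if "W \<in> cylinders X (Q n)" for W
    proof -
      have "openin X W" using openin_cylinders[OF _ that] Suc.IH by blast
      then have "X closure_of W \<in> regularly_closed X" unfolding regularly_closed_def by blast
      then show ?thesis by (rule weak_kappa_metricD(4)[OF d])
    qed
    then show ?case using Suc.IH countable_cylinders[of "Q n" X] unfolding Q_Suc step_def by auto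
  qed
  have mono: "Q m \<subseteq> Q n" if "m \<le> n" for m n
    by (rule lift_Suc_mono_le[OF _ that]) (simp add: Q_Suc step_def)
  have chain: "A \<subseteq> B \<or> B \<subseteq> A" if AB: "A \<in> range Q" "B \<in> range Q" for A B
  proof -
    obtain m n where "A = Q m" "B = Q n" using AB by blast
    then show ?thesis using mono[of m n] mono[of n m] by (cases "m \<le> n") simp_all
  qed
  have "(\<lambda>x. d x (X closure_of W)) \<in> \<Union>(range Q)" if "W \<in> cylinders X (\<Union>(range Q))" for W
  proof -
    have "\<exists>P\<in>range Q. W \<in> cylinders X P"
      by (rule cylinders_Union_chain[OF _ chain that]) simp_all
    then obtain n where "W \<in> cylinders X (Q n)" by blast
    then have "(\<lambda>x. d x (X closure_of W)) \<in> Q (Suc n)" unfolding Q_Suc step_def by blast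
    then show ?thesis by blast
  qed
  moreover have 0: "insert (\<lambda>_. 0) S \<subseteq> \<Union>(range Q)"
    using UN_upper[of 0 UNIV Q] by (simp add: Q_def)
  moreover have "countable (\<Union>(range Q))" using Q by simp
  moreover have "\<forall>f\<in>\<Union>(range Q). continuous_map X euclideanreal f" using Q by blast
  ultimately have "\<Union>(range Q) \<in> admissible X d" unfolding admissible_def by blast
  then show ?thesis using 0 by blast
qed

section \<open>Skeletality of the diagonal maps\<close>

lemma skeletal_eval_map:
  fixes X :: "'a topology"
  assumes X: "compact_space X" and d: "weak_kappa_metric X d" and P: "P \<in> admissible X d"
  shows "skeletal_map X (eval_space X P) (eval_map P)"
  unfolding skeletal_map_def
proof (intro conjI allI impI)
  let ?f = "eval_map P" and ?Y = "eval_space X P"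
  show cf: "continuous_map X ?Y ?f" by (rule continuous_map_eval_map[OF admissibleD(1,3)[OF P]])
  fix U assume "openin X U \<and> U \<noteq> {}"
  then have U: "openin X U" "U \<noteq> {}" by simp_all
  show "?Y interior_of (?Y closure_of (?f ` U)) \<noteq> {}"
  proof
    assume empty: "?Y interior_of (?Y closure_of (?f ` U)) = {}"
    have UX: "U \<subseteq> topspace X" by (rule openin_subset[OF U(1)])
    \<comment> \<open>The exterior of the image of \<open>U\<close>; it is dense because the closure
      of that image has empty interior.\<close>
    define G where "G = topspace ?Y - ?Y closure_of (?f ` U)"
    have G: "openin ?Y G" unfolding G_def by (rule openin_diff[OF openin_topspace closedin_closure_of])
    have G_dense: "?Y closure_of G = topspace ?Y" unfolding G_def closure_of_complement empty by simp
    define V where "V = {x \<in> topspace X. ?f x \<in> G}"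
    have VU: "V \<inter> U = {}"
    proof -
      have "?f ` U \<subseteq> ?Y closure_of (?f ` U)"
        using UX by (intro closure_of_subset) (auto simp: topspace_eval_space)
      then show ?thesis unfolding V_def G_def by blast
    qed
    define \<W> where "\<W> = {W \<in> cylinders X P. W \<subseteq> V}"
    have W_ne: "\<W> \<noteq> {}" unfolding \<W>_def using empty_in_cylinders[of X P] by blast
    have W_count: "countable \<W>"
      unfolding \<W>_def using countable_cylinders[OF admissibleD(2)[OF P], of X] by simp
    have W_cover: "\<exists>W\<in>\<W>. x \<in> W" if "x \<in> V" for x
    proof -
      obtain H where H: "open H" "G = ?f ` topspace X \<inter> H"
        using G unfolding eval_space_def openin_open by blast
      have "x \<in> topspace X" "?f x \<in> H" using that H(2) unfolding V_def by blast+
      then obtain W where W: "W \<in> cylinders X P" "x \<in> W" "\<forall>y\<in>W. ?f y \<in> H"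
        using cylinder_base[OF admissibleD(1)[OF P] _ H(1)] by blast
      have "W \<subseteq> topspace X" using W(1) unfolding cylinders_def cylinder_def by blast
      then have "W \<subseteq> V" unfolding V_def H(2) using W(3) by blast
      then show ?thesis using W unfolding \<W>_def by blast
    qed
    \<comment> \<open>Partial unions of an enumeration of the cylinders inside \<open>V\<close>.
      They are again such cylinders and increase to \<open>V\<close>, so K4 applies to their
      closures.\<close>
    define S where "S n = (\<Union>k\<le>n. from_nat_into \<W> k)" for n :: nat
    have S: "S n \<in> \<W>" for n
    proof (induction n)
      case 0
      show ?case unfolding S_def using from_nat_into[OF W_ne] by simp
    next
      case (Suc n)
      have "S (Suc n) = from_nat_into \<W> (Suc n) \<union> S n" unfolding S_def by (simp add: atMost_Suc)
      then show ?case
        using Suc.IH from_nat_into[OF W_ne, of "Suc n"] Un_in_cylinders[of _ X P _] unfolding \<W>_def by simp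
    qed
    have S_open: "openin X (S n)" for n
      using openin_cylinders[OF admissibleD(3)[OF P]] S[of n] unfolding \<W>_def by simp
    define C where "C n = X closure_of (S n)" for n
    have C_reg: "C n \<in> regularly_closed X" for n
      unfolding C_def regularly_closed_def using S_open by blast
    have C_inc: "incseq C"
    proof (rule incseq_SucI)
      fix n
      have "S n \<subseteq> S (Suc n)" unfolding S_def by (auto simp: atMost_Suc)
      then show "C n \<subseteq> C (Suc n)" unfolding C_def by (rule closure_of_mono)
    qed
    have dC: "(\<lambda>x. d x (C n)) \<in> P" for n
      unfolding C_def using admissibleD(4)[OF P] S[of n] unfolding \<W>_def by simp
    define \<phi> where "\<phi> x = (INF c\<in>range C. d x c)" for x
    have "continuous_map X euclideanreal (\<lambda>x. INF c\<in>range C. d x c)"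
      by (rule weak_kappa_metric_INF[OF d _ well_order_on_range_incseq[OF C_inc]])
        (use C_reg in auto)
    then have \<phi>_cont: "continuous_map X euclideanreal \<phi>" by (simp add: \<phi>_def[abs_def])
    have \<phi>_le: "\<phi> x \<le> d x (C n)" if "x \<in> topspace X" for x n
    proof -
      have "bdd_below ((\<lambda>c. d x c) ` range C)"
        using weak_kappa_metricD(1)[OF d that] C_reg by (intro bdd_belowI[of _ 0]) auto
      then show ?thesis unfolding \<phi>_def by (intro cINF_lower) simp_all
    qed
    \<comment> \<open>A point of \<open>V\<close> lies in some \<open>C k\<close>, where K1 forbids
      a positive distance to \<open>C k\<close>.\<close>
    have \<phi>_V: "\<phi> x \<le> 0" if "x \<in> V" for x
    proof -
      have xX: "x \<in> topspace X" using that unfolding V_def by simp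
      obtain W where W: "W \<in> \<W>" "x \<in> W" using W_cover \<open>x \<in> V\<close> by blast
      obtain k where k: "from_nat_into \<W> k = W" using from_nat_into_surj[OF W_count W(1)] by blast
      have "x \<in> S k" unfolding S_def using W(2) k by auto
      then have "x \<in> C k"
        unfolding C_def using closure_of_subset[OF openin_subset[OF S_open[of k]]] by blast
      obtain D where D: "openin (subtopology X (topspace X - C k)) D"
        "\<forall>x\<in>topspace X. 0 < d x (C k) \<longleftrightarrow> x \<in> D"
        using weak_kappa_metricD(2)[OF d C_reg[of k]] by blast
      have "x \<notin> D" using openin_subset[OF D(1)] \<open>x \<in> C k\<close> by auto
      then have "\<not> 0 < d x (C k)" using bspec[OF D(2) xX] by blast
      then show ?thesis using \<phi>_le[OF xX, of k] by linarith
    qed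
    have \<phi>_fibre: "\<phi> x = \<phi> y" if "?f x = ?f y" for x y
    proof -
      have eq: "\<forall>f\<in>P. f x = f y"
        using that eval_map_eq_iff[OF admissibleD(2,1)[OF P]] by simp
      have "d x (C n) = d y (C n)" for n using bspec[OF eq dC[of n]] .
      then show ?thesis unfolding \<phi>_def image_image by simp
    qed
    \<comment> \<open>The set \<open>N\<close> is closed, is a union of fibres within
      \<open>X\<close> and contains \<open>V\<close>. By compactness its image is closed; it
      contains the dense set \<open>G\<close>, so it is everything.\<close>
    have \<phi>_all: "\<phi> x \<le> 0" if "x \<in> topspace X" for x
    proof (rule ccontr)
      assume "\<not> \<phi> x \<le> 0"
      define N where "N = {z \<in> topspace X. \<phi> z \<le> 0}"
      have "closedin X N"
        unfolding N_def using \<phi>_cont unfolding continuous_map_upper_lower_semicontinuous_le by blast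
      moreover have "closed_map X ?Y ?f"
        by (rule T1_Spaces.continuous_imp_closed_map[OF cf X Hausdorff_eval_space])
      ultimately have "closedin ?Y (?f ` N)" unfolding closed_map_def by blast
      then have op: "openin ?Y (topspace ?Y - ?f ` N)" by (rule openin_diff[OF openin_topspace])
      have "?f x \<notin> ?f ` N"
      proof
        assume "?f x \<in> ?f ` N"
        then obtain z where "z \<in> N" "?f x = ?f z" by blast
        then show False using \<phi>_fibre[of x z] \<open>\<not> \<phi> x \<le> 0\<close> unfolding N_def by simp
      qed
      then have fx: "?f x \<in> topspace ?Y - ?f ` N" using that by (simp add: topspace_eval_space)
      have "?f x \<in> ?Y closure_of G" unfolding G_dense using fx by blast
      then obtain y where y: "y \<in> G" "y \<in> topspace ?Y - ?f ` N"
        using fx op unfolding in_closure_of by blast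
      then obtain z where z: "z \<in> topspace X" "y = ?f z" by (auto simp: topspace_eval_space)
      then have "z \<in> V" using y(1) unfolding V_def by simp
      then have "z \<in> N" using \<phi>_V z(1) unfolding N_def by simp
      then show False using y(2) z(2) by blast
    qed
    have V_open: "openin X V" unfolding V_def by (rule openin_continuous_map_preimage[OF cf G])
    \<comment> \<open>\<open>U\<close> misses \<open>K\<close>, so K1 yields a point of
      \<open>U\<close> at positive distance from \<open>K\<close>. As all \<open>C n\<close> lie in
      \<open>K\<close>, K2 bounds \<open>\<phi>\<close> below by that distance.\<close>
    define K where "K = X closure_of V"
    have K_reg: "K \<in> regularly_closed X" unfolding K_def regularly_closed_def using V_open by blast
    have CK: "C n \<subseteq> K" for n
      unfolding C_def K_def using S[of n] unfolding \<W>_def by (intro closure_of_mono) simp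
    have "U \<inter> K = {}" unfolding K_def using VU U(1) openin_Int_closure_of_eq_empty by blast
    then have UK: "U \<subseteq> topspace X - K" using UX by blast
    obtain D where D: "subtopology X (topspace X - K) closure_of D = topspace X - K"
      "\<forall>x\<in>topspace X. 0 < d x K \<longleftrightarrow> x \<in> D"
      using weak_kappa_metricD(2)[OF d K_reg] by blast
    obtain u where u: "u \<in> U" using U(2) by blast
    have "openin (subtopology X (topspace X - K)) U"
      using U(1) UK unfolding openin_subtopology by blast
    moreover have "u \<in> subtopology X (topspace X - K) closure_of D" unfolding D(1) using u UK by blast
    ultimately obtain x where x: "x \<in> D" "x \<in> U" using u unfolding in_closure_of by blast
    have xX: "x \<in> topspace X" using x(2) UX by blast
    have "0 < d x K" using D(2) xX x(1) by blast
    also have "d x K \<le> \<phi> x"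
      unfolding \<phi>_def
    proof (rule cINF_greatest)
      fix c assume "c \<in> range C"
      then obtain n where "c = C n" by blast
      then show "d x K \<le> d x c" using weak_kappa_metricD(3)[OF d C_reg K_reg CK xX] by simp
    qed simp
    finally show False using \<phi>_all[OF xX] by simp
  qed
qed

section \<open>Assembling the inverse system\<close>

lemma Hausdorff_inverse_limit:
  assumes "\<And>a. a \<in> A \<Longrightarrow> Hausdorff_space (Y a)"
  shows "Hausdorff_space (inverse_limit A r Y p)"
  unfolding inverse_limit_def
  by (rule Hausdorff_space_subtopology) (use assms in \<open>simp add: Hausdorff_space_product_topology\<close>)

lemma compact_Hausdorff_separated:
  assumes "compact_space X" "Hausdorff_space X" "x \<in> topspace X" "y \<in> topspace X" "x \<noteq> y"
  obtains f where "continuous_map X euclideanreal f" "f x \<noteq> f y"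
proof -
  have "normal_space X" using assms(1,2) by (simp add: compact_Hausdorff_or_regular_imp_normal_space)
  moreover have "closedin X {x}" "closedin X {y}"
    using assms(2-4) by (simp_all add: closedin_Hausdorff_singleton)
  moreover have "disjnt {x} {y}" using assms(5) by simp
  ultimately obtain f where "continuous_map X euclideanreal f" "f ` {x} \<subseteq> {0}" "f ` {y} \<subseteq> {1}"
    by (rule Urysohn_lemma_alt)
  then show thesis using that[of f] by simp
qed

text \<open>The fibres of \<open>f n\<close> over \<open>z n\<close> are nonempty, closed and
  decreasing in a compact space. So every thread over a sequence of indices comes from a point of
  \<open>X\<close>.\<close>

lemma eval_sequence_limit:
  assumes X: "compact_space X"
    and f: "\<And>n. continuous_map X (Y n) (f n)" "\<And>n. f n ` topspace X = topspace (Y n)"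
    and Y: "\<And>n. Hausdorff_space (Y n)"
    and p: "\<And>m n x. m \<le> n \<Longrightarrow> p n m (f n x) = f m x"
    and z: "\<And>n. z n \<in> topspace (Y n)" "\<And>m n. m \<le> n \<Longrightarrow> p n m (z n) = z m"
  obtains x where "x \<in> topspace X" "\<And>n :: nat. f n x = z n"
proof -
  define K where "K n = {x \<in> topspace X. f n x \<in> {z n}}" for n
  have "(\<Inter>n. K n) \<noteq> {}"
  proof (rule compact_space_imp_nest[OF X])
    show "closedin X (K n)" for n
      unfolding K_def
      by (rule closedin_continuous_map_preimage[OF f(1)]) (simp add: closedin_Hausdorff_singleton Y z(1))
    show "K n \<noteq> {}" for n
    proof -
      have "z n \<in> f n ` topspace X" using z(1) f(2) by simp
      then show ?thesis unfolding K_def by auto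
    qed
    show "decseq K"
      unfolding decseq_def
    proof (intro allI impI subsetI)
      fix m n x assume mn: "m \<le> n" and x: "x \<in> K n"
      have "f m x = p n m (z n)" using p[OF mn, of x] x unfolding K_def by simp
      then show "x \<in> K m" using x z(2)[OF mn] unfolding K_def by simp
    qed
  qed
  then obtain x where "\<And>n. x \<in> K n" by blast
  then show thesis using that[of x] unfolding K_def by simp
qed

lemma weakly_kappa_metrizable_imp_skeletally_generated:
  fixes X :: "'a topology"
  assumes X: "compact_space X" "Hausdorff_space X" and "weakly_kappa_metrizable X"
  shows "skeletally_generated X"
proof -
  obtain d where d: "weak_kappa_metric X d" using assms(3) unfolding weakly_kappa_metrizable_def by blast
  define A where "A = admissible X d"
  define r where "r = {(P, Q). P \<in> A \<and> Q \<in> A \<and> P \<subseteq> Q}"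
  define Y where "Y P = eval_space X P" for P
  define p where "p Q P = reindex Q P" for Q P :: "('a \<Rightarrow> real) set"
  have A: "P \<noteq> {}" "countable P" "\<And>f. f \<in> P \<Longrightarrow> continuous_map X euclideanreal f" if "P \<in> A" for P
    using admissibleD(1-3)[of P X d] that unfolding A_def by simp_all
  have ec: "continuous_map X (Y P) (eval_map P)" if "P \<in> A" for P
    unfolding Y_def by (rule continuous_map_eval_map[OF A(1,3)[OF that]])
  have es: "topspace (Y P) = eval_map P ` topspace X" for P
    unfolding Y_def by (rule topspace_eval_space)
  have rD: "P \<in> A" "Q \<in> A" "P \<subseteq> Q" if "(P, Q) \<in> r" for P Q using that unfolding r_def by simp_all
  have pe: "p Q P (eval_map Q x) = eval_map P x" if "(P, Q) \<in> r" for P Q x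
    unfolding p_def by (rule reindex_eval_map[OF A(2)[OF rD(2)[OF that]] rD(3)[OF that] A(1)[OF rD(1)[OF that]]])
  have pc: "continuous_map (Y Q) (Y P) (p Q P)" if "(P, Q) \<in> r" for P Q
    unfolding p_def Y_def
    by (rule continuous_map_reindex[OF A(2)[OF rD(2)[OF that]] rD(3)[OF that] A(1)[OF rD(1)[OF that]]])
  have rrefl: "(P, P) \<in> r" if "P \<in> A" for P using that unfolding r_def by simp
  have tr: "(P, R) \<in> r" if "(P, Q) \<in> r" "(Q, R) \<in> r" for P Q R using that unfolding r_def by auto
  have HY: "Hausdorff_space (Y P)" for P unfolding Y_def by (rule Hausdorff_eval_space)
  have cofinal: "\<exists>P\<in>A. S \<subseteq> P" if "countable S" "\<And>f. f \<in> S \<Longrightarrow> continuous_map X euclideanreal f" for S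
    unfolding A_def by (rule admissible_cofinal[OF d that])
  have "directed_order A r"
    unfolding directed_order_def
  proof (intro conjI ballI)
    show "A \<noteq> {}" using cofinal[of "{}"] by auto
    show "partial_order_on A r"
      unfolding partial_order_on_def preorder_on_def r_def
      by (auto simp: refl_on_def trans_def antisym_def)
    fix P Q assume PQ: "P \<in> A" "Q \<in> A"
    have "countable (P \<union> Q)" using A(2) PQ by simp
    moreover have "continuous_map X euclideanreal f" if "f \<in> P \<union> Q" for f using that A(3) PQ by blast
    ultimately obtain R where "R \<in> A" "P \<union> Q \<subseteq> R" using cofinal[of "P \<union> Q"] by blast
    then show "\<exists>R\<in>A. (P, R) \<in> r \<and> (Q, R) \<in> r" using PQ unfolding r_def by blast
  qed
  then have sys: "inverse_system A r Y p"
    unfolding inverse_system_def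
  proof (intro conjI)
    show "\<forall>(P, Q)\<in>r. continuous_map (Y Q) (Y P) (p Q P)" using pc by blast
    show "\<forall>P\<in>A. \<forall>y\<in>topspace (Y P). p P P y = y" unfolding es using pe[OF rrefl] by auto
    show "\<forall>P Q R. (P, Q) \<in> r \<and> (Q, R) \<in> r \<longrightarrow> (\<forall>y\<in>topspace (Y R). p Q P (p R Q y) = p R P y)"
    proof (intro allI impI ballI, elim conjE)
      fix P Q R y assume r: "(P, Q) \<in> r" "(Q, R) \<in> r" and "y \<in> topspace (Y R)"
      then obtain x where "y = eval_map R x" unfolding es by blast
      then show "p Q P (p R Q y) = p R P y" using pe[OF r(1)] pe[OF r(2)] pe[OF tr[OF r]] by simp
    qed
  qed
  \<comment> \<open>An open set of \<open>Y Q\<close> is the image of its preimage in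
    \<open>X\<close>, and \<open>p Q P\<close> composed with \<open>eval_map Q\<close> is
    \<open>eval_map P\<close>; skeletality of the latter therefore transfers to the bonding
    map.\<close>
  have skel: "skeletal_map (Y Q) (Y P) (p Q P) \<and> p Q P ` topspace (Y Q) = topspace (Y P)"
    if PQ: "(P, Q) \<in> r" for P Q
  proof
    show "p Q P ` topspace (Y Q) = topspace (Y P)" unfolding es image_image pe[OF PQ] ..
    show "skeletal_map (Y Q) (Y P) (p Q P)"
      unfolding skeletal_map_def
    proof (intro conjI allI impI)
      show "continuous_map (Y Q) (Y P) (p Q P)" by (rule pc[OF PQ])
      fix U assume U: "openin (Y Q) U \<and> U \<noteq> {}"
      define V where "V = {x \<in> topspace X. eval_map Q x \<in> U}"
      have "openin X V"
        unfolding V_def using openin_continuous_map_preimage[OF ec[OF rD(2)[OF PQ]]] U by blast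
      moreover have UV: "U = eval_map Q ` V"
        using openin_subset[of "Y Q" U] U unfolding V_def es by blast
      moreover have "V \<noteq> {}" using U UV by blast
      moreover have "skeletal_map X (Y P) (eval_map P)"
        unfolding Y_def using rD(1)[OF PQ] unfolding A_def by (rule skeletal_eval_map[OF X(1) d])
      ultimately have "Y P interior_of (Y P closure_of (eval_map P ` V)) \<noteq> {}"
        unfolding skeletal_map_def by blast
      moreover have "p Q P ` U = eval_map P ` V" unfolding UV image_image pe[OF PQ] ..
      ultimately show "Y P interior_of (Y P closure_of (p Q P ` U)) \<noteq> {}" by simp
    qed
  qed
  have Un_sup: "is_supremum A r C (\<Union>C)" if C: "C \<subseteq> A" "C \<noteq> {}" "countable C" "C \<in> Chains r" for C
  proof -
    have "P \<subseteq> Q \<or> Q \<subseteq> P" if "P \<in> C" "Q \<in> C" for P Q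
      using C(4) that unfolding Chains_def r_def by blast
    then have "\<Union>C \<in> A" using C(1-3) unfolding A_def by (intro admissible_Union_chain) simp_all
    then show ?thesis unfolding is_supremum_def r_def using C(1) by blast
  qed
  have seq: "embedding_map (Y b) (inverse_limit (UNIV :: nat set) {(m, n). m \<le> n} (\<lambda>n. Y (s n)) (\<lambda>n m. p (s n) (s m)))
        (\<lambda>y n. p b (s n) y) \<and>
      inverse_limit (UNIV :: nat set) {(m, n). m \<le> n} (\<lambda>n. Y (s n)) (\<lambda>n m. p (s n) (s m)) closure_of
        ((\<lambda>y n. p b (s n) y) ` topspace (Y b)) =
      topspace (inverse_limit (UNIV :: nat set) {(m, n). m \<le> n} (\<lambda>n. Y (s n)) (\<lambda>n m. p (s n) (s m)))"
    (is "embedding_map _ ?L ?h \<and> _")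
    if s: "range s \<subseteq> A" "\<forall>n. (s n, s (Suc n)) \<in> r" "is_supremum A r (range s) b" for s b
  proof -
    have sA: "s n \<in> A" for n using s(1) by blast
    have smono: "(s m, s n) \<in> r" if "m \<le> n" for m n
      using that
    proof (induction rule: dec_induct)
      case base
      show ?case by (rule rrefl[OF sA])
    next
      case (step n)
      show ?case by (rule tr[OF step.IH]) (use s(2) in blast)
    qed
    have "range s \<in> Chains r"
      unfolding Chains_def using smono by (auto intro: nat_le_linear[THEN disjE])
    then have "is_supremum A r (range s) (\<Union>(range s))" using Un_sup s(1) by simp
    then have b: "b = \<Union>(range s)" and bA: "b \<in> A" and sb: "\<And>n. (s n, b) \<in> r"
      using s(3) unfolding is_supremum_def r_def by blast+
    have hx: "?h (eval_map b x) = (\<lambda>n. eval_map (s n) x)" for x using pe[OF sb] by simp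
    have sp: "p (s n) (s m) (eval_map (s n) x) = eval_map (s m) x" if "m \<le> n" for m n x
      by (rule pe[OF smono[OF that]])
    have "continuous_map (Y b) (product_topology (\<lambda>n. Y (s n)) UNIV) ?h"
      unfolding continuous_map_componentwise_UNIV using pc[OF sb] by simp
    moreover have "?h y \<in> {x. \<forall>(m, n)\<in>{(m, n). m \<le> n}. p (s n) (s m) (x n) = x m}"
      if "y \<in> topspace (Y b)" for y
    proof -
      obtain x where "y = eval_map b x" using \<open>y \<in> topspace (Y b)\<close> unfolding es by blast
      then show ?thesis using hx sp by auto
    qed
    ultimately have hc: "continuous_map (Y b) ?L ?h"
      unfolding inverse_limit_def continuous_map_in_subtopology by blast
    \<comment> \<open>Since \<open>b\<close> is the union of the sets \<open>s n\<close>, points of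
      \<open>X\<close> with equal images at every stage agree on all functions in
      \<open>b\<close>.\<close>
    have "inj_on ?h (topspace (Y b))"
    proof (rule inj_onI)
      fix y y' assume "y \<in> topspace (Y b)" "y' \<in> topspace (Y b)" and eq: "?h y = ?h y'"
      then obtain x x' where x: "y = eval_map b x" "y' = eval_map b x'" unfolding es by blast
      have "f x = f x'" if "f \<in> b" for f
      proof -
        obtain n where "f \<in> s n" using \<open>f \<in> b\<close> unfolding b by blast
        moreover have "eval_map (s n) x = eval_map (s n) x'"
          using fun_cong[OF eq, of n] pe[OF sb[of n]] unfolding x by simp
        ultimately show ?thesis using eval_map_eq_iff[OF A(2,1)[OF sA]] by blast
      qed
      then show "y = y'" unfolding x using eval_map_eq_iff[OF A(2,1)[OF bA]] by blast
    qed
    moreover have "compact_space (Y b)"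
      using compact_eval_space[OF X(1)] ec[OF bA] unfolding Y_def by blast
    moreover have "Hausdorff_space ?L" by (rule Hausdorff_inverse_limit[OF HY])
    ultimately have emb: "embedding_map (Y b) ?L ?h"
      using hc by (intro continuous_imp_embedding_map)
    \<comment> \<open>Every thread lifts to \<open>X\<close>, so \<open>Y b\<close> maps onto the
      limit of the sequence, which in particular gives density.\<close>
    have "topspace ?L \<subseteq> ?h ` topspace (Y b)"
    proof
      fix z assume z: "z \<in> topspace ?L"
      have z1: "z n \<in> topspace (Y (s n))" for n
        using z unfolding inverse_limit_def by (auto simp: PiE_iff)
      have z2: "p (s n) (s m) (z n) = z m" if "m \<le> n" for m n
        using z that unfolding inverse_limit_def by auto
      obtain x where x: "x \<in> topspace X" "\<And>n. eval_map (s n) x = z n"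
        by (rule eval_sequence_limit[of X "\<lambda>n. Y (s n)" "\<lambda>n. eval_map (s n)" "\<lambda>n m. p (s n) (s m)" z,
              OF X(1) ec[OF sA] es[symmetric] HY sp z1 z2]) (assumption, assumption, rule that)
      have "z = ?h (eval_map b x)" unfolding hx using x(2) by auto
      moreover have "eval_map b x \<in> topspace (Y b)" unfolding es using x(1) by blast
      ultimately show "z \<in> ?h ` topspace (Y b)" by blast
    qed
    moreover have "?h ` topspace (Y b) \<subseteq> topspace ?L"
      by (rule continuous_map_image_subset_topspace[OF hc])
    ultimately have "?h ` topspace (Y b) = topspace ?L" by (rule subset_antisym[rotated])
    then show ?thesis using emb by simp
  qed
  \<comment> \<open>Restriction to \<open>A\<close> is required because points of the product
    topology are extensional functions.\<close>
  define e where "e x = (\<lambda>P\<in>A. eval_map P x)" for x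
  have "embedding_map X (inverse_limit A r Y p) e"
  proof (rule continuous_imp_embedding_map[OF _ X(1)])
    show "Hausdorff_space (inverse_limit A r Y p)" by (rule Hausdorff_inverse_limit[OF HY])
    have "continuous_map X (product_topology Y A) e"
      unfolding continuous_map_componentwise
    proof (intro conjI ballI)
      show "e ` topspace X \<subseteq> extensional A" unfolding e_def by auto
      show "continuous_map X (Y P) (\<lambda>x. e x P)" if "P \<in> A" for P
        using ec[OF that] that by (simp add: e_def)
    qed
    moreover have "e x \<in> {x. \<forall>(a, b)\<in>r. p b a (x b) = x a}" for x
      using pe rD by (auto simp: e_def)
    ultimately show "continuous_map X (inverse_limit A r Y p) e"
      unfolding inverse_limit_def continuous_map_in_subtopology by blast
    \<comment> \<open>Distinct points are separated by a continuous function, and by cofinality that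
      function belongs to some index.\<close>
    show "inj_on e (topspace X)"
    proof (rule inj_onI, rule ccontr)
      fix x y assume xy: "x \<in> topspace X" "y \<in> topspace X" "e x = e y" "x \<noteq> y"
      obtain f where f: "continuous_map X euclideanreal f" "f x \<noteq> f y"
        by (rule compact_Hausdorff_separated[OF X xy(1,2,4)])
      obtain P where P: "P \<in> A" "{f} \<subseteq> P" using cofinal[of "{f}"] f(1) by auto
      have "eval_map P x = eval_map P y" using fun_cong[OF xy(3), of P] P(1) by (simp add: e_def)
      then show False using f(2) P(2) eval_map_eq_iff[OF A(2,1)[OF P(1)]] by blast
    qed
  qed
  moreover have "\<forall>P\<in>A. (\<lambda>x. e x P) ` topspace X = topspace (Y P)"
    unfolding es by (simp add: e_def)
  ultimately have emb: "\<exists>e. embedding_map X (inverse_limit A r Y p) e \<and>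
      (\<forall>P\<in>A. (\<lambda>x. e x P) ` topspace X = topspace (Y P))"
    by blast
  have "skeletal_presentation X A r Y p"
    unfolding skeletal_presentation_def Let_def
  proof (intro conjI sys emb)
    show "\<forall>P\<in>A. metrizable_space (Y P) \<and> separable_space (Y P)"
      unfolding Y_def by (simp add: metrizable_eval_space separable_eval_space)
    show "\<forall>(P, Q)\<in>r. skeletal_map (Y Q) (Y P) (p Q P) \<and> p Q P ` topspace (Y Q) = topspace (Y P)"
      using skel by blast
    show "sigma_complete A r" unfolding sigma_complete_def using Un_sup by blast
  qed (use seq in blast)
  then show ?thesis unfolding skeletally_generated_def by blast
qed

text \<open>A presentation over arbitrary index and point types yields a weak kappa-metric, and from
  it the converse construction builds a presentation over the types fixed in
  \<open>skeletally_generated\<close>; the second conjunct thus shows that fixing them loses no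
  compact Hausdorff space.\<close>

theorem theorem4p1:
  fixes X :: "'a topology"
    and A :: "'i set" and r :: "'i rel"
    and Y :: "'i \<Rightarrow> 'b topology" and p :: "'i \<Rightarrow> 'i \<Rightarrow> 'b \<Rightarrow> 'b"
  assumes "compact_space X" and "Hausdorff_space X"
  shows "(skeletally_generated X \<longleftrightarrow> weakly_kappa_metrizable X) \<and>
         (skeletal_presentation X A r Y p \<longrightarrow> skeletally_generated X)"
proof (intro conjI iffI impI)
  assume "skeletally_generated X"
  then show "weakly_kappa_metrizable X"
    unfolding skeletally_generated_def
    using skeletal_presentation_imp_weakly_kappa_metrizable by blast
next
  assume "weakly_kappa_metrizable X"
  then show "skeletally_generated X"
    by (rule weakly_kappa_metrizable_imp_skeletally_generated[OF assms])
next
  assume "skeletal_presentation X A r Y p"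
  then have "weakly_kappa_metrizable X"
    by (rule skeletal_presentation_imp_weakly_kappa_metrizable)
  then show "skeletally_generated X"
    by (rule weakly_kappa_metrizable_imp_skeletally_generated[OF assms])
qed

end
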